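(* If the Hamiltonian vanishes, $H=0$, then the coupled spin-oscillator has a third constant of motion, given by $K_{uv}(x,y,z,u,v)=\arg(u+iv)$ and $K_{xy}(x,y,z,u,v)=\arg(x+iy)$ (i.e. each of these functions Poisson-commutes with $H$ at the points of $\{H=0\}$ where it is defined). Together they define an integral on $\{H=0\}$ that is smooth almost everywhere, and all orbits of the system on $\{H=0\}$ are closed.
   Context: Coupled spin-oscillator: $M=\mathbb{S}^2\times\mathbb{R}^2$ with Cartesian coordinates $(x,y,z)$ on the unit sphere $\mathbb{S}^2\subset\mathbb{R}^3$ and $(u,v)$ on $\mathbb{R}^2$, symplectic form $\omega=\lambda\,\omega_{\mathbb{S}^2}\oplus\mu\,\omega_{\mathbb{R}^2}$ with $\lambda,\mu>0$ constants and $\omega_{\mathbb{S}^2},\omega_{\mathbb{R}^2}$ the standard symplectic structures, and commuting integrals $$L=\mu\frac{u^2+v^2}{2}+\lambda(z-1),\qquad H=\frac{xu+yv}{2}.$$ The dynamics considered is the Hamiltonian flow of $H$, with $\omega(\mathcal X_H,\cdot)=-dH$. The function $K_{uv}$ is defined where $(u,v)\ne(0,0)$ and $K_{xy}$ where $(x,y)\neq(0,0)$. On the level set $H=0$ the two functions are dependent, so that they define only one additional integral.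
   Formalization: Orbits on {H=0} with L=0 other than the equilibrium (0,0,1,0,0) are homoclinic to it, hence not closed; for them it is shown instead that adding this point gives a closed curve (a circle), while all other orbits on {H=0} are shown to be periodic. *)

theory Defs
  imports "HOL-Analysis.Analysis" "HOL-Library.Real_Mod"
begin

text \<open>The phase space is the product of the unit sphere and the plane, embedded in
  \<^typ>\<open>(real^3) \<times> (real^2)\<close>; a point is \<open>((x, y, z), (u, v))\<close>.
  Functions on it are given on (open subsets of) the ambient space; everything below depends
  only on the restriction of their differentials to the tangent spaces of the phase space.\<close>

type_synonym state = "(real^3) \<times> (real^2)"

definition phase_space :: "state set" where
  "phase_space = {p. norm (fst p) = 1}"

definition tangent_space :: "state \<Rightarrow> state set" where
  "tangent_space p = {\<xi>. fst p \<bullet> fst \<xi> = 0}"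

definition xy :: "state \<Rightarrow> complex" where
  "xy p = Complex (fst p $ 1) (fst p $ 2)"

definition uv :: "state \<Rightarrow> complex" where
  "uv p = Complex (snd p $ 1) (snd p $ 2)"

text \<open>The factors are \<open>dz \<and> d\<theta>\<close> on the sphere (the area form \<open>a, b \<mapsto> p \<bullet> (b \<times> a)\<close>) and
  \<open>du \<and> dv\<close> on the plane. Relative to the convention \<open>\<omega>(X_f, \<cdot>) = - df\<close>, this choice of
  relative orientation is the one for which the integrals \<open>L\<close> and \<open>H\<close> below commute.\<close>

definition sympl :: "real \<Rightarrow> real \<Rightarrow> state \<Rightarrow> state \<Rightarrow> state \<Rightarrow> real" where
  "sympl lam mu p \<xi> \<eta> =
     lam * (fst p \<bullet> cross3 (fst \<eta>) (fst \<xi>)) +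
     mu * (snd \<xi> $ 1 * snd \<eta> $ 2 - snd \<xi> $ 2 * snd \<eta> $ 1)"

definition ham_vf :: "real \<Rightarrow> real \<Rightarrow> (state \<Rightarrow> real) \<Rightarrow> state \<Rightarrow> state" where
  "ham_vf lam mu f p =
     (THE \<xi>. \<xi> \<in> tangent_space p \<and>
        (\<forall>\<eta>\<in>tangent_space p. sympl lam mu p \<xi> \<eta> = - frechet_derivative f (at p) \<eta>))"

definition poisson :: "real \<Rightarrow> real \<Rightarrow> (state \<Rightarrow> real) \<Rightarrow> (state \<Rightarrow> real) \<Rightarrow> state \<Rightarrow> real" where
  "poisson lam mu f g p = sympl lam mu p (ham_vf lam mu f p) (ham_vf lam mu g p)"

definition L :: "real \<Rightarrow> real \<Rightarrow> state \<Rightarrow> real" where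
  "L lam mu p = mu * ((snd p $ 1)\<^sup>2 + (snd p $ 2)\<^sup>2) / 2 + lam * (fst p $ 3 - 1)"

definition H :: "state \<Rightarrow> real" where
  "H p = (fst p $ 1 * snd p $ 1 + fst p $ 2 * snd p $ 2) / 2"

definition north :: state where "north = (vector [0, 0, 1], 0)"

definition south :: state where "south = (vector [0, 0, -1], 0)"

text \<open>\<open>C^k\<close> functions by iterated directional derivatives (on open sets).\<close>

fun Ck_on :: "nat \<Rightarrow> 'a::real_normed_vector set \<Rightarrow> ('a \<Rightarrow> real) \<Rightarrow> bool" where
  "Ck_on 0 U f \<longleftrightarrow> continuous_on U f"
| "Ck_on (Suc k) U f \<longleftrightarrow>
     (\<forall>x\<in>U. f differentiable (at x)) \<and>
     (\<forall>w. Ck_on k U (\<lambda>x. frechet_derivative f (at x) w))"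

definition smooth_on :: "'a::real_normed_vector set \<Rightarrow> ('a \<Rightarrow> real) \<Rightarrow> bool" where
  "smooth_on U f \<longleftrightarrow> open U \<and> (\<forall>k. Ck_on k U f)"

text \<open>An angle is a function with values in the reals modulo \<open>m\<close>; it is represented by an
  arbitrary, possibly discontinuous, real-valued choice \<open>F\<close>, such as the principal value
  \<^const>\<open>Arg\<close> with \<open>m = 2 \<pi>\<close>. Smoothness, differentials and Poisson brackets are those of its
  local smooth real-valued lifts, here near a point \<open>p\<close> of the domain \<open>D\<close>.\<close>

definition smooth_lift ::
  "real \<Rightarrow> (state \<Rightarrow> real) \<Rightarrow> state set \<Rightarrow> state \<Rightarrow> state set \<Rightarrow> (state \<Rightarrow> real) \<Rightarrow> bool" where
  "smooth_lift m F D p U K \<longleftrightarrow>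
     p \<in> U \<and> smooth_on U K \<and> (\<forall>q\<in>U \<inter> D. [K q = F q] (rmod m))"

definition angle_smooth_on :: "real \<Rightarrow> (state \<Rightarrow> real) \<Rightarrow> state set \<Rightarrow> bool" where
  "angle_smooth_on m F D \<longleftrightarrow> (\<forall>p\<in>D. \<exists>U K. smooth_lift m F D p U K)"

definition independent_at ::
  "state \<Rightarrow> (state \<Rightarrow> real) \<Rightarrow> (state \<Rightarrow> real) \<Rightarrow> (state \<Rightarrow> real) \<Rightarrow> bool" where
  "independent_at p f g h \<longleftrightarrow>
     (\<forall>a b c. (\<forall>\<eta>\<in>tangent_space p.
          a * frechet_derivative f (at p) \<eta> + b * frechet_derivative g (at p) \<eta> +
          c * frechet_derivative h (at p) \<eta> = 0) \<longrightarrow> a = 0 \<and> b = 0 \<and> c = 0)"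

text \<open>A third constant of motion on \<open>H = 0\<close>: the angle commutes with \<open>H\<close> there, and it is
  functionally independent of \<open>L\<close> and \<open>H\<close>.\<close>

definition third_constant :: "real \<Rightarrow> real \<Rightarrow> real \<Rightarrow> (state \<Rightarrow> real) \<Rightarrow> state set \<Rightarrow> bool" where
  "third_constant lam mu m F D \<longleftrightarrow>
     angle_smooth_on m F D \<and>
     (\<forall>p U K. p \<in> D \<and> H p = 0 \<and> smooth_lift m F D p U K \<longrightarrow>
        poisson lam mu K H p = 0 \<and> independent_at p (L lam mu) H K)"

definition K_uv :: "state \<Rightarrow> real" where "K_uv p = Arg (uv p)"

definition K_xy :: "state \<Rightarrow> real" where "K_xy p = Arg (xy p)"

definition dom_uv :: "state set" where "dom_uv = {p \<in> phase_space. uv p \<noteq> 0}"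

definition dom_xy :: "state set" where "dom_xy = {p \<in> phase_space. xy p \<noteq> 0}"

definition zero_level :: "state set" where "zero_level = {p \<in> phase_space. H p = 0}"

text \<open>On \<open>H = 0\<close> the planar vectors \<open>(x, y)\<close> and \<open>(u, v)\<close> are orthogonal, so \<open>K_uv\<close> and
  \<open>K_xy + \<pi>/2\<close> agree only modulo \<open>\<pi>\<close>; the joint angle is to be read modulo \<open>\<pi>\<close>.
  Its value at \<^const>\<open>north\<close> and \<^const>\<open>south\<close> is meaningless.\<close>

definition K_joint :: "state \<Rightarrow> real" where
  "K_joint p = (if uv p \<noteq> 0 then K_uv p else K_xy p + pi / 2)"

definition integral_curve ::
  "real \<Rightarrow> real \<Rightarrow> (state \<Rightarrow> real) \<Rightarrow> real set \<Rightarrow> (real \<Rightarrow> state) \<Rightarrow> bool" where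
  "integral_curve lam mu f I \<gamma> \<longleftrightarrow>
     (\<forall>t\<in>I. \<gamma> t \<in> phase_space \<and> (\<gamma> has_vector_derivative ham_vf lam mu f (\<gamma> t)) (at t within I))"

definition orbit :: "real \<Rightarrow> real \<Rightarrow> (state \<Rightarrow> real) \<Rightarrow> state \<Rightarrow> state set" where
  "orbit lam mu f p =
     {\<gamma> t | \<gamma> I t. open I \<and> is_interval I \<and> 0 \<in> I \<and> t \<in> I \<and> \<gamma> 0 = p \<and> integral_curve lam mu f I \<gamma>}"

definition complete_curve_of ::
  "real \<Rightarrow> real \<Rightarrow> (state \<Rightarrow> real) \<Rightarrow> state \<Rightarrow> (real \<Rightarrow> state) \<Rightarrow> bool" where
  "complete_curve_of lam mu f p \<gamma> \<longleftrightarrow>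
     integral_curve lam mu f UNIV \<gamma> \<and> \<gamma> 0 = p \<and> range \<gamma> = orbit lam mu f p"

definition closed_orbit :: "real \<Rightarrow> real \<Rightarrow> (state \<Rightarrow> real) \<Rightarrow> state \<Rightarrow> bool" where
  "closed_orbit lam mu f p \<longleftrightarrow>
     (\<exists>\<gamma> T. complete_curve_of lam mu f p \<gamma> \<and> T > 0 \<and> (\<forall>t. \<gamma> (t + T) = \<gamma> t))"

definition homoclinic_orbit :: "real \<Rightarrow> real \<Rightarrow> (state \<Rightarrow> real) \<Rightarrow> state \<Rightarrow> state \<Rightarrow> bool" where
  "homoclinic_orbit lam mu f e p \<longleftrightarrow>
     (\<exists>\<gamma>. complete_curve_of lam mu f p \<gamma> \<and> e \<notin> range \<gamma> \<and>
        (\<gamma> \<longlongrightarrow> e) at_top \<and> (\<gamma> \<longlongrightarrow> e) at_bot)"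

end

theory Submission
  imports Defs
begin

text \<open>The level \<open>H = 0\<close> is foliated by meridians: \<open>u + i v = \<rho> exp (i \<phi>)\<close> and
  \<open>x + i y = - i s exp (i \<phi>)\<close> with \<open>s\<^sup>2 + z\<^sup>2 = 1\<close>. The flow of \<open>H\<close> fixes \<open>\<phi>\<close>, which is both
  angles up to constants, and moves \<open>(s, z, \<rho>)\<close> as a pendulum with energy \<open>L\<close> and unstable
  equilibrium at the north pole. Rotations (\<open>L > 0\<close>) and librations (\<open>L < 0\<close>) become, after a
  change of variable, solutions of a scalar equation \<open>\<psi>' = f \<psi>\<close> with \<open>f\<close> positive and periodic,
  hence are periodic; the separatrix (\<open>L = 0\<close>) is explicit in hyperbolic functions. Uniqueness
  of integral curves identifies these solutions with the orbits. A lift of an angle differs from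
  it by a discrete amount, so its derivative along a curve is read off from the angle itself:
  it is 1 along the simultaneous rotation of both planes, which \<open>L\<close> and \<open>H\<close> do not see, and 0
  along the flow of \<open>H\<close>.\<close>

section \<open>Hamiltonian vector fields\<close>

text \<open>A lift in \<open>third_constant\<close> is an arbitrary smooth function on an ambient
  open set, tied to the angle only at points of \<open>D\<close>; for \<open>K_joint\<close> this
  \<open>D\<close> even lies inside the zero level. Its differential is therefore known only along
  curves that stay in \<open>D\<close>. The rotation and the flow of \<open>H\<close> are two such
  curves, and they suffice: a linear relation between the three differentials is tested on the
  rotation first, and the bracket with \<open>H\<close> is the derivative along the flow. The
  coordinates s and \<rho> may change sign. An orbit through (u, v) = 0 or (x, y) = 0 then keeps one
  meridian and one \<phi>, although the principal argument jumps by \<pi> there. Hence the modulus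
  \<pi> for the joint angle, while \<open>K_uv\<close> and \<open>K_xy\<close> are followed modulo 2
  \<pi> for short times only. The case L = 0 stands apart because the speed of the pendulum, as a
  function of its angle, has a zero at the north pole: the pole is approached but not reached, and
  there is no period to compute.\<close>

lemmas vec_simps = vector_3 vector_2 forall_3 forall_2 sum_3 sum_2 inner_vec_def vec_eq_iff

text \<open>The vector of \<open>sympl_ham_vf\<close> for the ambient gradient (u, v, 0) / 2, (x, y)
  / 2 of \<open>H\<close>. It is a quadratic polynomial map on the whole ambient space, so integral
  curves are solutions of an ordinary differential equation there.\<close>

definition H_field :: "real \<Rightarrow> real \<Rightarrow> state \<Rightarrow> state" where
  "H_field lam mu p =
     ((1 / (2 * lam)) *\<^sub>R vector [snd p $ 2 * fst p $ 3, - (snd p $ 1 * fst p $ 3),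
        snd p $ 1 * fst p $ 2 - snd p $ 2 * fst p $ 1],
      (1 / (2 * mu)) *\<^sub>R vector [- (fst p $ 2), fst p $ 1])"

lemma phase_space_iff: "p \<in> phase_space \<longleftrightarrow> (fst p $ 1)\<^sup>2 + (fst p $ 2)\<^sup>2 + (fst p $ 3)\<^sup>2 = 1"
  by (simp add: phase_space_def norm_eq_1 inner_vec_def sum_3 power2_eq_square)

lemma tangent_space_iff:
  "\<xi> \<in> tangent_space p \<longleftrightarrow>
     fst p $ 1 * fst \<xi> $ 1 + fst p $ 2 * fst \<xi> $ 2 + fst p $ 3 * fst \<xi> $ 3 = 0"
  by (simp add: tangent_space_def inner_vec_def sum_3)

text \<open>Each component of \<xi> is tested against its own quarter turn. On the sphere this is
  the cross product with the base point, and the form returns lam times the squared norm; in the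
  plane it returns mu times the squared norm.\<close>

lemma sympl_nondegenerate:
  assumes "lam > 0" "mu > 0" "p \<in> phase_space"
    and "\<xi> \<in> tangent_space p" and "\<And>\<eta>. \<eta> \<in> tangent_space p \<Longrightarrow> sympl lam mu p \<xi> \<eta> = 0"
  shows "\<xi> = 0"
proof -
  have unit: "fst p \<bullet> fst p = 1" and orth: "fst p \<bullet> fst \<xi> = 0"
    using assms by (simp_all add: phase_space_def norm_eq_1 tangent_space_def)
  have "(cross3 (fst \<xi>) (fst p), 0) \<in> tangent_space p"
    by (simp add: tangent_space_def dot_cross_self)
  from assms(5)[OF this] assms(1) have "fst p \<bullet> cross3 (cross3 (fst \<xi>) (fst p)) (fst \<xi>) = 0"
    by (simp add: sympl_def)
  moreover have "fst p \<bullet> cross3 (cross3 (fst \<xi>) (fst p)) (fst \<xi>) = fst \<xi> \<bullet> fst \<xi>"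
  proof -
    have "cross3 (cross3 (fst \<xi>) (fst p)) (fst \<xi>) = (fst \<xi> \<bullet> fst \<xi>) *\<^sub>R fst p"
      using orth cross_skew[of "cross3 (fst \<xi>) (fst p)" "fst \<xi>"]
      by (simp add: Lagrange inner_commute)
    then show ?thesis using unit by simp
  qed
  ultimately have 1: "fst \<xi> = 0" by simp
  have "sympl lam mu p \<xi> (0, vector [- (snd \<xi> $ 2), snd \<xi> $ 1]) = 0"
    by (rule assms(5)) (simp add: tangent_space_def)
  then have "(snd \<xi> $ 1)\<^sup>2 + (snd \<xi> $ 2)\<^sup>2 = 0"
    using assms(2) by (simp add: sympl_def 1 cross_zero_right power2_eq_square vector_2)
  then have "snd \<xi> = 0"
    by (simp add: vec_simps sum_power2_eq_zero_iff)
  with 1 show ?thesis by (simp add: prod_eq_iff)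
qed

lemma linear_state_eq:
  fixes D :: "state \<Rightarrow> real"
  assumes "linear D"
  shows "D \<eta> = fst \<eta> \<bullet> (\<chi> i. D (axis i 1, 0)) + snd \<eta> \<bullet> (\<chi> i. D (0, axis i 1))"
proof -
  have expand: "(\<Sum>i\<in>UNIV. x $ i *\<^sub>R axis i 1) = x" for x :: "real ^ 'n"
    using basis_expansion[of x] by (simp add: scalar_mult_eq_scaleR)
  have "\<eta> = (\<Sum>i\<in>UNIV. fst \<eta> $ i *\<^sub>R (axis i 1, 0)) + (\<Sum>i\<in>UNIV. snd \<eta> $ i *\<^sub>R (0, axis i 1))"
    by (simp add: prod_eq_iff fst_sum snd_sum expand)
  then have "D \<eta> = D ((\<Sum>i\<in>UNIV. fst \<eta> $ i *\<^sub>R (axis i 1, 0)) + (\<Sum>i\<in>UNIV. snd \<eta> $ i *\<^sub>R (0, axis i 1)))"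
    by simp
  also have "\<dots> = (\<Sum>i\<in>UNIV. fst \<eta> $ i * D (axis i 1, 0)) + (\<Sum>i\<in>UNIV. snd \<eta> $ i * D (0, axis i 1))"
    using assms by (simp only: linear_add linear_sum linear_scale o_def real_scaleR_def)
  finally show ?thesis by (simp add: inner_vec_def)
qed

lemma ham_vf_unique:
  assumes "lam > 0" "mu > 0" "p \<in> phase_space" "linear (frechet_derivative f (at p))"
    and "\<xi> \<in> tangent_space p"
    and "\<And>\<eta>. \<eta> \<in> tangent_space p \<Longrightarrow> sympl lam mu p \<xi> \<eta> = - frechet_derivative f (at p) \<eta>"
  shows "ham_vf lam mu f p = \<xi>"
  unfolding ham_vf_def
proof (rule the_equality)
  fix \<xi>' assume *: "\<xi>' \<in> tangent_space p \<and>
    (\<forall>\<eta>\<in>tangent_space p. sympl lam mu p \<xi>' \<eta> = - frechet_derivative f (at p) \<eta>)"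
  have "sympl lam mu p (\<xi>' - \<xi>) \<eta> = sympl lam mu p \<xi>' \<eta> - sympl lam mu p \<xi> \<eta>" for \<eta>
    by (simp add: sympl_def cross3_def inner_vec_def sum_3 vector_3 algebra_simps)
  then have "\<xi>' - \<xi> = 0"
    using * assms
    by (intro sympl_nondegenerate[OF assms(1-3)]) (auto simp: tangent_space_def inner_diff_right)
  then show "\<xi>' = \<xi>" by simp
qed (simp_all add: assms)

text \<open>Existence of the vector behind \<open>THE\<close>, needed for every differentiable
  \<open>f\<close> because a lift is arbitrary. If (g, h) is the ambient gradient, the vector is (g
  \<times> p / lam, J h / mu) with J the quarter turn; the cross product with the base point
  discards the normal part of g.\<close>

lemma sympl_ham_vf:
  assumes "lam > 0" "mu > 0" "p \<in> phase_space" "f differentiable (at p)" "\<eta> \<in> tangent_space p"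
  shows "sympl lam mu p (ham_vf lam mu f p) \<eta> = - frechet_derivative f (at p) \<eta>"
proof -
  let ?D = "frechet_derivative f (at p)"
  have lin: "linear ?D"
    using assms(4) frechet_derivative_works has_derivative_linear by blast
  define g where "g = (\<chi> i. ?D (axis i 1, 0))"
  define h where "h = (\<chi> i. ?D (0, axis i 1))"
  define \<xi> :: state where
    "\<xi> = ((1 / lam) *\<^sub>R cross3 g (fst p), (1 / mu) *\<^sub>R vector [- (h $ 2), h $ 1])"
  have tan: "\<xi> \<in> tangent_space p"
    by (simp add: \<xi>_def tangent_space_def dot_cross_self)
  have eq: "sympl lam mu p \<xi> \<eta> = - ?D \<eta>" if "\<eta> \<in> tangent_space p" for \<eta>
  proof -
    have "cross3 (fst \<eta>) (cross3 g (fst p)) = - ((fst \<eta> \<bullet> g) *\<^sub>R fst p)"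
      using that by (simp add: Lagrange tangent_space_def inner_commute)
    then have "lam * (fst p \<bullet> cross3 (fst \<eta>) (fst \<xi>)) = - (fst \<eta> \<bullet> g)"
      using assms(1,3) by (simp add: \<xi>_def cross_mult_right phase_space_def norm_eq_1)
    moreover have "mu * (snd \<xi> $ 1 * snd \<eta> $ 2 - snd \<xi> $ 2 * snd \<eta> $ 1) = - (snd \<eta> \<bullet> h)"
      using assms(2) by (simp add: \<xi>_def vec_simps field_simps)
    ultimately show ?thesis
      using linear_state_eq[OF lin, of \<eta>] by (simp add: sympl_def g_def h_def)
  qed
  show ?thesis
    using ham_vf_unique[OF assms(1-3) lin tan eq] eq assms(5) by simp
qed

lemma has_derivative_components [derivative_intros]:
  fixes p :: state
  shows "((\<lambda>x. fst x $ i) has_derivative (\<lambda>h. fst h $ i)) (at p)"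
    and "((\<lambda>x. snd x $ j) has_derivative (\<lambda>h. snd h $ j)) (at p)"
  by (auto intro!: bounded_linear_imp_has_derivative
      bounded_linear_compose[OF bounded_linear_vec_nth bounded_linear_fst]
      bounded_linear_compose[OF bounded_linear_vec_nth bounded_linear_snd])

lemma has_derivative_H:
  "(H has_derivative (\<lambda>\<eta>. (fst p $ 1 * snd \<eta> $ 1 + fst \<eta> $ 1 * snd p $ 1 +
      (fst p $ 2 * snd \<eta> $ 2 + fst \<eta> $ 2 * snd p $ 2)) / 2)) (at p)"
  unfolding H_def[abs_def] by (auto intro!: derivative_eq_intros simp: algebra_simps)

lemma has_derivative_L:
  "(L lam mu has_derivative (\<lambda>\<eta>. mu * (snd p $ 1 * snd \<eta> $ 1 + snd p $ 2 * snd \<eta> $ 2) +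
      lam * fst \<eta> $ 3)) (at p)"
  unfolding L_def[abs_def] by (auto intro!: derivative_eq_intros simp: algebra_simps)

lemmas frechet_H = frechet_derivative_at[OF has_derivative_H, symmetric]
lemmas frechet_L = frechet_derivative_at[OF has_derivative_L, symmetric]

lemma H_field_tangent: "H_field lam mu p \<in> tangent_space p"
  by (simp add: H_field_def tangent_space_iff vector_3 algebra_simps)

lemma ham_vf_H:
  assumes "lam > 0" "mu > 0" "p \<in> phase_space"
  shows "ham_vf lam mu H p = H_field lam mu p"
proof (rule ham_vf_unique[OF assms _ H_field_tangent])
  show "linear (frechet_derivative H (at p))"
    unfolding frechet_H using has_derivative_H has_derivative_linear by blast
next
  fix \<eta> assume t: "\<eta> \<in> tangent_space p"
  define a b c where "a = fst p $ 1" and "b = fst p $ 2" and "c = fst p $ 3"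
  define a' b' c' where "a' = fst \<eta> $ 1" and "b' = fst \<eta> $ 2" and "c' = fst \<eta> $ 3"
  define u v u' v' where "u = snd p $ 1" and "v = snd p $ 2" and "u' = snd \<eta> $ 1" and "v' = snd \<eta> $ 2"
  note d = a_def b_def c_def a'_def b'_def c'_def u_def v_def u'_def v'_def
  have 1: "a\<^sup>2 + b\<^sup>2 + c\<^sup>2 = 1" and 2: "a * a' + b * b' + c * c' = 0"
    using assms t by (auto simp: phase_space_iff tangent_space_iff d)
  have "fst p \<bullet> cross3 (fst \<eta>) (vector [v * c, - (u * c), u * b - v * a]) =
     a * (b' * (u * b - v * a) + c' * (u * c)) + b * (c' * (v * c) - a' * (u * b - v * a)) +
     c * (- (a' * (u * c)) - b' * (v * c))"
    by (simp add: cross3_def inner_vec_def sum_3 vector_3 d)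
  also have "\<dots> = - (u * a' + v * b')"
    using 1 2 by algebra
  finally have 3: "lam * (fst p \<bullet> cross3 (fst \<eta>) (fst (H_field lam mu p))) = - (u * a' + v * b') / 2"
    using assms(1) by (simp add: H_field_def cross_mult_right d)
  then show "sympl lam mu p (H_field lam mu p) \<eta> = - frechet_derivative H (at p) \<eta>"
    using assms(2) unfolding frechet_H sympl_def 3
    by (simp add: d H_field_def vector_2 field_simps)
qed

text \<open>Only the field of \<open>H\<close> remains, so the bracket with an unknown lift becomes
  a derivative along one known vector.\<close>

lemma poisson_H:
  assumes "lam > 0" "mu > 0" "p \<in> phase_space" "f differentiable (at p)"
  shows "poisson lam mu f H p = - frechet_derivative f (at p) (H_field lam mu p)"
  unfolding poisson_def ham_vf_H[OF assms(1-3)]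
  by (rule sympl_ham_vf[OF assms H_field_tangent])

text \<open>The formula of \<open>sympl_ham_vf\<close> applied to \<open>L\<close> gives this
  vector: it is the Hamiltonian field of \<open>L\<close>.\<close>

definition rotation_field :: "state \<Rightarrow> state" where
  "rotation_field p = (vector [- (fst p $ 2), fst p $ 1, 0], vector [- (snd p $ 2), snd p $ 1])"

text \<open>Written with scalar functions of time times fixed vectors, so that the derivative at 0
  and the value at 0 can be read off; subtracting the multiple of \<open>north\<close> leaves the
  part that rotates.\<close>

definition rotation :: "real \<Rightarrow> state \<Rightarrow> state" where
  "rotation t p = p + sin t *\<^sub>R rotation_field p + (cos t - 1) *\<^sub>R (p - (fst p $ 3) *\<^sub>R north)"

text \<open>The rotation annihilates the differentials of \<open>L\<close> and \<open>H\<close>,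
  which isolates c. The other two coefficients are separated by vectors chosen according to which of
  (u, v), (x, y) vanishes.\<close>

lemma independent_at_L_H:
  assumes "lam > 0" "mu > 0" "p \<in> phase_space" "H p = 0" "uv p \<noteq> 0 \<or> xy p \<noteq> 0"
    and "linear (frechet_derivative K (at p))"
    and K: "frechet_derivative K (at p) (rotation_field p) \<noteq> 0"
  shows "independent_at p (L lam mu) H K"
  unfolding independent_at_def
proof (intro allI impI)
  fix a b c
  define x y z u v where "x = fst p $ 1" and "y = fst p $ 2" and "z = fst p $ 3"
    and "u = snd p $ 1" and "v = snd p $ 2"
  note d = x_def y_def z_def u_def v_def
  assume "\<forall>\<eta>\<in>tangent_space p. a * frechet_derivative (L lam mu) (at p) \<eta> +
      b * frechet_derivative H (at p) \<eta> + c * frechet_derivative K (at p) \<eta> = 0"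
  then have *: "a * (mu * (u * snd \<eta> $ 1 + v * snd \<eta> $ 2) + lam * fst \<eta> $ 3) +
      b * ((x * snd \<eta> $ 1 + fst \<eta> $ 1 * u + (y * snd \<eta> $ 2 + fst \<eta> $ 2 * v)) / 2) +
      c * frechet_derivative K (at p) \<eta> = 0" if "\<eta> \<in> tangent_space p" for \<eta>
    using that unfolding frechet_L frechet_H d by auto
  have orth: "x * u + y * v = 0"
    using assms(4) by (simp add: H_def d)
  have "rotation_field p \<in> tangent_space p"
    by (simp add: rotation_field_def tangent_space_iff vector_3)
  from *[OF this] orth K have c: "c = 0"
    by (simp add: rotation_field_def vector_3 vector_2 d algebra_simps)
  have "a = 0 \<and> b = 0"
  proof (cases "uv p = 0")
    case False
    then have nz: "u\<^sup>2 + v\<^sup>2 \<noteq> 0"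
      by (auto simp: uv_def d complex_eq_iff sum_power2_eq_zero_iff)
    \<comment> \<open>Radial in the plane: \<open>L\<close> changes, \<open>H\<close> does not since
      (x, y) and (u, v) are orthogonal.\<close>
    have "(0, snd p) \<in> tangent_space p"
      by (simp add: tangent_space_def)
    from *[OF this] have "a * (mu * (u\<^sup>2 + v\<^sup>2)) + b * ((x * u + y * v) / 2) = 0"
      by (simp add: c d power2_eq_square algebra_simps)
    then have a: "a = 0" using nz orth assms(2) by auto
    show ?thesis
    proof (cases "xy p = 0")
      case True
      then have xy: "x = 0" "y = 0" by (auto simp: xy_def d complex_eq_iff)
      \<comment> \<open>Over a pole of the sphere every horizontal vector is tangent.\<close>
      have "(vector [u, v, 0], 0) \<in> tangent_space p"
        using xy by (simp add: tangent_space_iff vector_3 d)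
      from *[OF this] have "b * (u\<^sup>2 + v\<^sup>2) = 0"
        by (simp add: c a vector_3 power2_eq_square)
      with nz a show ?thesis by auto
    next
      case False
      then have nz: "x\<^sup>2 + y\<^sup>2 \<noteq> 0"
        by (auto simp: xy_def d complex_eq_iff sum_power2_eq_zero_iff)
      have "(0, vector [x, y]) \<in> tangent_space p"
        by (simp add: tangent_space_def)
      from *[OF this] have "b * (x\<^sup>2 + y\<^sup>2) = 0"
        by (simp add: c a vector_2 power2_eq_square)
      with nz a show ?thesis by auto
    qed
  next
    case True
    then have uv: "u = 0" "v = 0" by (auto simp: uv_def d complex_eq_iff)
    have nz: "x\<^sup>2 + y\<^sup>2 \<noteq> 0"
      using True assms(5) by (auto simp: xy_def d complex_eq_iff sum_power2_eq_zero_iff)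
    have "(0, vector [x, y]) \<in> tangent_space p"
      by (simp add: tangent_space_def)
    from *[OF this] have "b * (x\<^sup>2 + y\<^sup>2) = 0"
      by (simp add: c uv vector_2 power2_eq_square)
    \<comment> \<open>The direction of steepest descent on the sphere. As (u, v) = 0,
      \<open>H\<close> is stationary along it while the height, and with it \<open>L\<close>,
      changes.\<close>
    moreover have "(vector [z * x, z * y, - (x\<^sup>2 + y\<^sup>2)], 0) \<in> tangent_space p"
      by (simp add: tangent_space_iff vector_3 d power2_eq_square algebra_simps)
    from *[OF this] have "a * (lam * (x\<^sup>2 + y\<^sup>2)) = 0"
      by (simp add: c uv vector_3 algebra_simps)
    ultimately show ?thesis using nz assms(1) by auto
  qed
  with c show "a = 0 \<and> b = 0 \<and> c = 0" by simp
qed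

section \<open>Angles and their lifts\<close>

lemma Ck_on_cong:
  assumes "open U" "\<And>x. x \<in> U \<Longrightarrow> f x = g x"
  shows "Ck_on k U f \<longleftrightarrow> Ck_on k U g"
  using assms(2)
proof (induction k arbitrary: f g)
  case 0
  then show ?case by (simp cong: continuous_on_cong)
next
  case (Suc k)
  have der: "(f has_derivative D) (at x) \<longleftrightarrow> (g has_derivative D) (at x)" if "x \<in> U" for x D
    using assms(1) that Suc.prems
    by (auto intro: has_derivative_transform_within_open[of _ D x UNIV U])
  then have eq: "frechet_derivative f (at x) = frechet_derivative g (at x)" if "x \<in> U" for x
    using that by (simp add: frechet_derivative_def)
  have "Ck_on k U (\<lambda>x. frechet_derivative f (at x) w) \<longleftrightarrow> Ck_on k U (\<lambda>x. frechet_derivative g (at x) w)" for w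
    using eq by (intro Suc.IH) simp
  moreover have "f differentiable (at x) \<longleftrightarrow> g differentiable (at x)" if "x \<in> U" for x
    using der[OF that] by (simp add: differentiable_def)
  ultimately show ?case by simp
qed

text \<open>Allows the recursive clause to be checked on an explicit derivative in place of the
  chosen \<open>frechet_derivative\<close>.\<close>

lemma Ck_on_SucI:
  assumes "open U" "\<And>x. x \<in> U \<Longrightarrow> (f has_derivative D x) (at x)" "\<And>w. Ck_on k U (\<lambda>x. D x w)"
  shows "Ck_on (Suc k) U f"
proof -
  have "Ck_on k U (\<lambda>x. frechet_derivative f (at x) w)" for w
    using assms by (subst Ck_on_cong[OF assms(1), of _ "\<lambda>x. D x w"])
      (auto dest!: assms(2) frechet_derivative_at)
  then show ?thesis
    using assms(2) by (auto simp: differentiable_def)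
qed

lemma Ck_on_SucD:
  assumes "Ck_on (Suc k) U f"
  shows "Ck_on k U f"
  using assms
proof (induction k arbitrary: f)
  case 0
  then have "f differentiable (at x)" if "x \<in> U" for x
    using that by simp
  then show ?case
    by (simp add: continuous_at_imp_continuous_on differentiable_imp_continuous_within)
qed simp

lemma Ck_on_const: "open U \<Longrightarrow> Ck_on k U (\<lambda>x. c)"
proof (induction k arbitrary: c)
  case (Suc k)
  then show ?case by (intro Ck_on_SucI[where D = "\<lambda>_ _. 0"]) auto
qed simp

lemma Ck_on_linear:
  assumes "open U" "bounded_linear f"
  shows "Ck_on k U f"
proof (cases k)
  case 0
  then show ?thesis
    using assms by (simp add: linear_continuous_on)
next
  case (Suc j)
  show ?thesis
    unfolding Suc using assms
    by (intro Ck_on_SucI[where D = "\<lambda>_. f"] Ck_on_const bounded_linear_imp_has_derivative)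
qed

lemma Ck_on_add:
  assumes "open U" "Ck_on k U f" "Ck_on k U g"
  shows "Ck_on k U (\<lambda>x. f x + g x)"
  using assms(2,3)
proof (induction k arbitrary: f g)
  case (Suc k)
  show ?case
    using Suc by (intro Ck_on_SucI[where D = "\<lambda>x w. frechet_derivative f (at x) w + frechet_derivative g (at x) w"]
        assms has_derivative_add) (auto simp: frechet_derivative_works)
qed (simp add: continuous_on_add)

lemma Ck_on_mult:
  assumes "open U" "Ck_on k U f" "Ck_on k U g"
  shows "Ck_on k U (\<lambda>x. f x * g x)"
  using assms(2,3)
proof (induction k arbitrary: f g)
  case (Suc k)
  \<comment> \<open>The product rule contains the undifferentiated factors, so their order of
    smoothness has to be lowered by one before the induction hypothesis applies.\<close>
  have "Ck_on k U f" "Ck_on k U g"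
    by (rule Ck_on_SucD, fact Suc.prems)+
  with Suc show ?case
    by (intro Ck_on_SucI[where D = "\<lambda>x w. f x * frechet_derivative g (at x) w + frechet_derivative f (at x) w * g x"]
        assms has_derivative_mult Ck_on_add) (auto simp: frechet_derivative_works)
qed (simp add: continuous_on_mult)

lemma Ck_on_inverse:
  assumes "open U" "Ck_on k U f" "\<And>x. x \<in> U \<Longrightarrow> f x \<noteq> 0"
  shows "Ck_on k U (\<lambda>x. inverse (f x))"
  using assms(2)
proof (induction k)
  case (Suc k)
  then have IH: "Ck_on k U (\<lambda>x. inverse (f x))"
    using Ck_on_SucD by blast
  show ?case
  proof (rule Ck_on_SucI[OF assms(1)])
    fix x assume "x \<in> U"
    then show "((\<lambda>x. inverse (f x)) has_derivative
        (\<lambda>w. (- 1) * (inverse (f x) * frechet_derivative f (at x) w * inverse (f x)))) (at x)"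
      using Suc.prems assms(3)
      by (auto intro!: derivative_eq_intros simp: frechet_derivative_works)
  next
    fix w
    have "Ck_on k U (\<lambda>x. frechet_derivative f (at x) w)"
      using Suc.prems by simp
    then show "Ck_on k U (\<lambda>x. (- 1) * (inverse (f x) * frechet_derivative f (at x) w * inverse (f x)))"
      by (intro Ck_on_mult Ck_on_const IH assms(1))
  qed
qed (use assms in \<open>auto intro: continuous_on_inverse\<close>)

lemma cis_Arg_eq: "z \<noteq> 0 \<Longrightarrow> z = of_real (cmod z) * cis (Arg z)"
  using rcis_cmod_Arg[of z] by (simp add: rcis_def)

lemma Arg_rcong_iff:
  assumes "z \<noteq> 0"
  shows "[Arg z = t] (rmod (2 * pi)) \<longleftrightarrow> sgn z = cis t"
  using assms by (simp add: cis_Arg cis_eq_iff[symmetric])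

text \<open>The lift at \<open>p\<close> is the imaginary part of \<open>Ln (l q / l p)\<close>, shifted by \<open>Arg (l p)\<close>; here
  \<open>l q / l p\<close> stays in the right half-plane. Its differential is \<open>Im (l w / l q)\<close>.\<close>

lemma smooth_lift_Arg:
  fixes l :: "'a::real_normed_vector \<Rightarrow> complex"
  assumes l: "bounded_linear l" and "l p \<noteq> 0"
  obtains U K where "p \<in> U" "smooth_on U K"
    "\<And>q. q \<in> U \<Longrightarrow> l q \<noteq> 0 \<and> [K q = Arg (l q)] (rmod (2 * pi))"
proof
  define U where "U = {q. Re (l q / l p) > 0}"
  define K where "K = (\<lambda>q. Im (Ln (l q / l p)) + Arg (l p))"
  have cont: "continuous_on UNIV (\<lambda>q. Re (l q / l p))"
    by (intro linear_continuous_on bounded_linear_compose[OF bounded_linear_Re]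
        bounded_linear_compose[OF bounded_linear_divide l])
  then have U: "open U"
    using open_Collect_less[of "\<lambda>_. 0"] by (simp add: U_def)
  show "p \<in> U" using assms(2) by (simp add: U_def)
  have nz: "l q \<noteq> 0" if "q \<in> U" for q
    using that by (auto simp: U_def)
  show "l q \<noteq> 0 \<and> [K q = Arg (l q)] (rmod (2 * pi))" if "q \<in> U" for q
  proof -
    have "cis (K q) = sgn (l q / l p) * sgn (l p)"
      using nz[OF that] assms(2) by (simp add: K_def Arg_eq_Im_Ln[symmetric] cis_mult[symmetric] cis_Arg)
    also have "\<dots> = sgn (l q / l p * l p)"
      by (simp only: sgn_mult)
    finally have "cis (K q) = sgn (l q)"
      using assms(2) by simp
    then show ?thesis
      using nz[OF that] Arg_rcong_iff[of "l q" "K q"] rcong_sym by auto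
  qed
  \<comment> \<open>Spelled out with sums, products and one inverse of linear functions, the
    operations under which \<open>Ck_on\<close> has been shown to be closed.\<close>
  have K': "(K has_derivative (\<lambda>w. (Re (l x) * Im (l w) + (- 1) * (Im (l x) * Re (l w))) *
      inverse (Re (l x) * Re (l x) + Im (l x) * Im (l x)))) (at x)" if "x \<in> U" for x
  proof -
    have "((\<lambda>q. l q / l p) has_derivative (\<lambda>w. l w / l p)) (at x)"
      by (rule bounded_linear_imp_has_derivative[OF bounded_linear_compose[OF bounded_linear_divide l]])
    moreover have "(Ln has_derivative (*) (inverse (l x / l p))) (at (l x / l p))"
      using that has_field_derivative_Ln[of "l x / l p"]
      by (auto simp: U_def complex_nonpos_Reals_iff has_field_derivative_def)
    ultimately have "((\<lambda>q. Ln (l q / l p)) has_derivative (\<lambda>w. inverse (l x / l p) * (l w / l p))) (at x)"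
      by (rule has_derivative_compose)
    then have "(K has_derivative (\<lambda>w. Im (inverse (l x / l p) * (l w / l p)))) (at x)"
      unfolding K_def by (auto intro!: derivative_eq_intros)
    moreover have "inverse (l x / l p) * (l w / l p) = l w / l x" for w
      using assms(2) nz[OF that] by (simp add: field_simps)
    moreover have "Im (l w / l x) = (Re (l x) * Im (l w) + (- 1) * (Im (l x) * Re (l w))) *
      inverse (Re (l x) * Re (l x) + Im (l x) * Im (l x))" for w
      by (simp add: Im_divide power2_eq_square divide_inverse algebra_simps)
    ultimately show ?thesis by simp
  qed
  have "Ck_on (Suc k) U K" for k
  proof (rule Ck_on_SucI[OF U K'])
    have "Re (l x) * Re (l x) + Im (l x) * Im (l x) \<noteq> 0" if "x \<in> U" for x
      using nz[OF that] by (simp add: complex_eq_iff sum_squares_eq_zero_iff)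
    moreover have "bounded_linear (\<lambda>x. Re (l x))" "bounded_linear (\<lambda>x. Im (l x))"
      using l bounded_linear_compose bounded_linear_Re bounded_linear_Im by blast+
    ultimately show "Ck_on k U (\<lambda>x. (Re (l x) * Im (l w) + (- 1) * (Im (l x) * Re (l w))) *
      inverse (Re (l x) * Re (l x) + Im (l x) * Im (l x)))" for w
      by (intro Ck_on_mult Ck_on_add Ck_on_inverse Ck_on_const Ck_on_linear U) auto
  qed
  then have "Ck_on k U K" for k
    by (rule Ck_on_SucD)
  with U show "smooth_on U K"
    by (simp add: smooth_on_def)
qed

lemma rcong_0_imp_eq_0:
  assumes "[x = 0] (rmod m)" "\<bar>x\<bar> < m"
  shows "x = 0"
proof -
  obtain n where n: "x = of_int n * m"
    using rcong_sym[OF assms(1)] by (auto simp: rcong_altdef)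
  moreover have "m > 0" using assms(2) by linarith
  ultimately have "\<bar>of_int n :: real\<bar> < 1"
    using assms(2) by (simp add: abs_mult)
  then have "n = 0" by linarith
  then show ?thesis using n by simp
qed

lemma smooth_on_differentiable: "smooth_on U K \<Longrightarrow> p \<in> U \<Longrightarrow> K differentiable (at p)"
  by (auto simp: smooth_on_def dest!: spec[where x = "Suc 0"])

text \<open>The difference \<open>g\<close> between the lift along the curve and its expected value
  is continuous, vanishes at 0 and takes values in the multiples of m near 0, so it vanishes nearby.
  Nothing about \<open>K\<close> off \<open>D\<close> enters.\<close>

lemma smooth_lift_derivative_along_curve:
  assumes lift: "smooth_lift m F D p U K" and "m > 0"
    and c: "(c has_vector_derivative \<eta>) (at 0)" "c 0 = p"
    and F: "\<forall>\<^sub>F t in nhds (0::real). c t \<in> D \<and> [F (c t) = F p + \<kappa> * t] (rmod m)"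
  shows "frechet_derivative K (at p) \<eta> = \<kappa>"
proof -
  have "open U" "p \<in> U" and eq: "\<And>q. q \<in> U \<inter> D \<Longrightarrow> [K q = F q] (rmod m)"
    using lift by (auto simp: smooth_lift_def smooth_on_def)
  have diff: "K differentiable (at p)"
    using lift smooth_on_differentiable by (auto simp: smooth_lift_def)
  then have "(K has_derivative frechet_derivative K (at p)) (at (c 0))"
    by (simp add: c(2) frechet_derivative_works)
  with c(1)[unfolded has_vector_derivative_def]
  have "((\<lambda>t. K (c t)) has_derivative (\<lambda>t. frechet_derivative K (at p) (t *\<^sub>R \<eta>))) (at 0)"
    by (rule has_derivative_compose)
  moreover have "linear (frechet_derivative K (at p))"
    using diff frechet_derivative_works has_derivative_linear by blast
  ultimately have K': "((\<lambda>t. K (c t)) has_field_derivative frechet_derivative K (at p) \<eta>) (at 0)"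
    unfolding has_field_derivative_def
    by (elim has_derivative_eq_rhs) (simp add: linear_scale mult.commute fun_eq_iff)
  define g where "g = (\<lambda>t. K (c t) - K p - \<kappa> * t)"
  have cont: "isCont c 0"
    using c(1) by (rule has_vector_derivative_continuous)
  then have "\<forall>\<^sub>F t in nhds 0. c t \<in> U"
    using \<open>open U\<close> \<open>p \<in> U\<close> c(2) by (simp add: continuous_at_open continuous_within tendsto_def eventually_nhds_conv_at)
  moreover have "isCont g 0"
    unfolding g_def using DERIV_isCont[OF K'] by (auto intro!: continuous_intros)
  then have "\<forall>\<^sub>F t in nhds 0. \<bar>g t\<bar> < m"
  proof -
    assume "isCont g 0"
    then have "(g \<longlongrightarrow> g 0) (nhds 0)"
      by (simp add: continuous_at tendsto_at_iff_tendsto_nhds)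
    then have "\<forall>\<^sub>F t in nhds 0. dist (g t) (g 0) < m"
      using \<open>m > 0\<close> by (rule tendstoD)
    then show ?thesis
      using c(2) by (simp add: g_def dist_real_def)
  qed
  ultimately have "\<forall>\<^sub>F t in nhds 0. g t = 0"
    using F
  proof eventually_elim
    case (elim t)
    \<comment> \<open>\<open>nhds\<close> includes the time 0 itself, and this puts p into
      \<open>D\<close>.\<close>
    have "p \<in> U \<inter> D"
      using eventually_nhds_x_imp_x[OF F] c(2) \<open>p \<in> U\<close> by auto
    then have "[K (c t) - K p = F p + \<kappa> * t - F p] (rmod m)"
      using elim eq by (meson IntI rcong_diff rcong_trans)
    then have "[K (c t) - K p - \<kappa> * t = \<kappa> * t - \<kappa> * t] (rmod m)"
      by (intro rcong_diff) auto
    then show ?case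
      using elim by (intro rcong_0_imp_eq_0[of _ m]) (auto simp: g_def)
  qed
  then have "(g has_field_derivative 0) (at 0)"
    by (subst DERIV_cong_ev[where g = "\<lambda>_. 0" and v = 0]) auto
  moreover have "(g has_field_derivative frechet_derivative K (at p) \<eta> - \<kappa>) (at 0)"
    unfolding g_def using K' by (auto intro!: derivative_eq_intros)
  ultimately show ?thesis
    using DERIV_unique by force
qed

section \<open>Ordinary differential equations\<close>

text \<open>Separation of variables: \<open>G\<close> is the time needed to travel from \<psi>0 to
  x, and \<psi> is its inverse. Crossing one period \<open>P\<close> of f always takes the same time
  \<open>T\<close>.\<close>

lemma autonomous_ode_periodic:
  fixes f :: "real \<Rightarrow> real"
  assumes cont: "continuous_on UNIV f" and pos: "\<And>x. f x > 0"
    and per: "\<And>x. f (x + P) = f x" and "P > 0"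
  obtains \<psi> T where "\<psi> 0 = \<psi>0" "T > 0" "\<And>t. (\<psi> has_real_derivative f (\<psi> t)) (at t)"
    "\<And>t. \<psi> (t + T) = \<psi> t + P"
proof -
  have nz: "f x \<noteq> 0" for x
    using pos[of x] by simp
  have "isCont (\<lambda>x. 1 / f x) x" for x
    using cont nz by (intro continuous_intros) (auto simp: continuous_on_eq_continuous_at)
  then obtain G0 where "\<And>x. (G0 has_vector_derivative 1 / f x) (at x)"
    using einterval_antiderivative[of "-\<infinity>" \<infinity> "\<lambda>x. 1 / f x"] by auto
  then have G0: "(G0 has_real_derivative 1 / f x) (at x)" for x
    by (simp add: has_real_derivative_iff_has_vector_derivative)
  define G where "G = (\<lambda>x. G0 x - G0 \<psi>0)"
  have G: "(G has_real_derivative 1 / f x) (at x)" for x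
    unfolding G_def using G0 by (auto intro!: derivative_eq_intros)
  have mono: "G x < G y" if "x < y" for x y
    using G pos that by (metis DERIV_pos_imp_increasing divide_pos_pos zero_less_one)
  define T where "T = G P - G 0"
  have "T > 0" using mono[OF \<open>P > 0\<close>] by (simp add: T_def)
  have GT: "G (x + P) = G x + T" for x
  proof -
    have "((\<lambda>x. G (x + P) - G x) has_real_derivative 0) (at x)" for x
    proof -
      have "((\<lambda>x. G (x + P)) has_real_derivative 1 / f (x + P)) (at x)"
        using G DERIV_shift by blast
      from DERIV_diff[OF this G[of x]] show ?thesis by (simp add: per)
    qed
    then have "G (x + P) - G x = G (0 + P) - G 0"
      using DERIV_isconst_all[of "\<lambda>x. G (x + P) - G x"] by blast
    then show ?thesis by (simp add: T_def)
  qed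
  have GTn: "G (x + of_nat n * P) = G x + of_nat n * T" for x n
  proof (induction n)
    case (Suc n)
    then show ?case using GT[of "x + of_nat n * P"] by (simp add: algebra_simps)
  qed simp
  have contG: "isCont G x" for x
    using G DERIV_isCont by blast
  \<comment> \<open>Since \<open>G\<close> gains T > 0 over each period, it is unbounded in both
    directions; hence the solution exists for all times.\<close>
  have surj: "\<exists>x. G x = y" for y
  proof -
    obtain n where "\<bar>y - G 0\<bar> < of_nat n * T"
      using reals_Archimedean3[OF \<open>T > 0\<close>] by blast
    then have "G (0 - of_nat n * P) \<le> y" "y \<le> G (0 + of_nat n * P)"
      using GTn[of "0 - of_nat n * P" n] GTn[of 0 n] by (simp_all add: abs_less_iff)
    then show ?thesis
      using IVT[of G "0 - of_nat n * P" y "0 + of_nat n * P"] contG \<open>P > 0\<close> by auto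
  qed
  then obtain \<psi> where \<psi>: "\<And>y. G (\<psi> y) = y" by metis
  have inj: "x = y" if "G x = G y" for x y
    using that mono by (metis less_irrefl linorder_neqE)
  have \<psi>G: "\<psi> (G x) = x" for x
    by (rule inj) (simp add: \<psi>)
  show thesis
  proof
    show "\<psi> 0 = \<psi>0" by (rule inj) (simp add: \<psi>, simp add: G_def)
    show "\<psi> (t + T) = \<psi> t + P" for t
      by (rule inj) (simp add: \<psi> GT)
    show "(\<psi> has_real_derivative f (\<psi> t)) (at t)" for t
    proof -
      have "isCont \<psi> (G (\<psi> t))"
        by (rule isCont_inverse_function[of 1]) (auto simp: \<psi>G contG)
      then have "(\<psi> has_real_derivative inverse (1 / f (\<psi> t))) (at t)"
        using pos[of "\<psi> t"] by (intro DERIV_inverse_function[OF G, of _ _ "t - 1" "t + 1"]) (auto simp: \<psi>)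
      then show ?thesis by simp
    qed
  qed (fact \<open>T > 0\<close>)
qed

text \<open>Gronwall: with \<open>C\<close> a Lipschitz constant of \<open>f\<close> on the ranges of both solutions,
  \<open>|\<gamma> - \<delta>|\<^sup>2 exp (- 2 C t)\<close> is decreasing.\<close>

lemma ode_unique_forward:
  fixes f :: "'a::real_inner \<Rightarrow> 'a"
  assumes lip: "\<And>S. bounded S \<Longrightarrow> \<exists>C. C-lipschitz_on S f"
    and \<gamma>: "\<And>t. 0 \<le> t \<Longrightarrow> t \<le> T \<Longrightarrow> (\<gamma> has_vector_derivative f (\<gamma> t)) (at t)"
    and \<delta>: "\<And>t. 0 \<le> t \<Longrightarrow> t \<le> T \<Longrightarrow> (\<delta> has_vector_derivative f (\<delta> t)) (at t)"
    and "\<gamma> 0 = \<delta> 0" "0 \<le> T"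
  shows "\<gamma> T = \<delta> T"
proof -
  have "continuous_on {0..T} \<gamma>" "continuous_on {0..T} \<delta>"
    using \<gamma> \<delta> by (auto intro!: continuous_at_imp_continuous_on has_vector_derivative_continuous)
  then have "bounded (\<gamma> ` {0..T} \<union> \<delta> ` {0..T})"
    by (auto intro!: compact_imp_bounded compact_continuous_image)
  then obtain C where C: "C-lipschitz_on (\<gamma> ` {0..T} \<union> \<delta> ` {0..T}) f"
    using lip by blast
  define h where "h = (\<lambda>t. ((\<gamma> t - \<delta> t) \<bullet> (\<gamma> t - \<delta> t)) * exp (- (2 * C * t)))"
  have "\<exists>y. (h has_real_derivative y) (at t) \<and> y \<le> 0" if "0 \<le> t" "t \<le> T" for t
  proof -
    define e where "e = \<gamma> t - \<delta> t"
    define e' where "e' = f (\<gamma> t) - f (\<delta> t)"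
    have 1: "((\<lambda>t. \<gamma> t - \<delta> t) has_vector_derivative e') (at t)"
      unfolding e'_def using \<gamma> \<delta> that by (auto intro!: derivative_eq_intros)
    have 2: "((\<lambda>t. (\<gamma> t - \<delta> t) \<bullet> (\<gamma> t - \<delta> t)) has_real_derivative 2 * (e \<bullet> e')) (at t)"
      unfolding has_field_derivative_def
      by (rule has_derivative_eq_rhs[OF has_derivative_inner[OF 1[unfolded has_vector_derivative_def]
              1[unfolded has_vector_derivative_def]]])
        (auto simp: e_def inner_commute algebra_simps)
    have "((\<lambda>t. exp (- (2 * C * t))) has_real_derivative - (2 * C) * exp (- (2 * C * t))) (at t)"
      by (auto intro!: derivative_eq_intros)
    from DERIV_mult[OF 2 this]
    have "(h has_real_derivative (2 * (e \<bullet> e') - 2 * C * (e \<bullet> e)) * exp (- (2 * C * t))) (at t)"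
      unfolding h_def e_def[symmetric] by (rule DERIV_cong) (simp add: algebra_simps)
    moreover have "e \<bullet> e' \<le> norm e * norm e'"
      by (rule norm_cauchy_schwarz)
    moreover have "norm e' \<le> C * norm e"
      using lipschitz_onD[OF C, of "\<gamma> t" "\<delta> t"] that by (auto simp: e_def e'_def dist_norm)
    then have "norm e * norm e' \<le> C * (e \<bullet> e)"
      using mult_left_mono[of "norm e'" "C * norm e" "norm e"]
      by (simp add: dot_square_norm power2_eq_square mult.left_commute)
    ultimately show ?thesis
      by (intro exI[of _ "(2 * (e \<bullet> e') - 2 * C * (e \<bullet> e)) * exp (- (2 * C * t))"] conjI)
        (auto intro!: mult_nonpos_nonneg)
  qed
  then have "h T \<le> h 0"
    by (rule DERIV_nonpos_imp_nonincreasing[OF \<open>0 \<le> T\<close>])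
  then have "((\<gamma> T - \<delta> T) \<bullet> (\<gamma> T - \<delta> T)) * exp (- (2 * C * T)) \<le> 0"
    using assms(4) by (simp add: h_def)
  then have "(\<gamma> T - \<delta> T) \<bullet> (\<gamma> T - \<delta> T) \<le> 0"
    by (simp add: mult_le_0_iff)
  then have "(\<gamma> T - \<delta> T) \<bullet> (\<gamma> T - \<delta> T) = 0"
    by (intro antisym inner_ge_zero)
  then show ?thesis by simp
qed

text \<open>Negative times reduce to the forward case by reversing time, which replaces f by - f and
  keeps the Lipschitz condition.\<close>

lemma ode_unique:
  fixes f :: "'a::real_inner \<Rightarrow> 'a"
  assumes lip: "\<And>S. bounded S \<Longrightarrow> \<exists>C. C-lipschitz_on S f"
    and "is_interval I" "0 \<in> I" "T \<in> I"
    and \<gamma>: "\<And>t. t \<in> I \<Longrightarrow> (\<gamma> has_vector_derivative f (\<gamma> t)) (at t)"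
    and \<delta>: "\<And>t. t \<in> I \<Longrightarrow> (\<delta> has_vector_derivative f (\<delta> t)) (at t)"
    and "\<gamma> 0 = \<delta> 0"
  shows "\<gamma> T = \<delta> T"
proof (cases "0 \<le> T")
  case True
  have "t \<in> I" if "0 \<le> t" "t \<le> T" for t
    using mem_is_interval_1_I[OF assms(2-4)] that by blast
  with True show ?thesis
    by (intro ode_unique_forward[OF lip \<gamma> \<delta> assms(7)])
next
  case False
  have I: "- t \<in> I" if "0 \<le> t" "t \<le> - T" for t
    using mem_is_interval_1_I[OF assms(2,4,3), of "- t"] that by simp
  have reflect: "((\<lambda>t. \<alpha> (- t)) has_vector_derivative - f (\<alpha> (- t))) (at t)"
    if "(\<alpha> has_vector_derivative f (\<alpha> (- t))) (at (- t))" for \<alpha> t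
  proof -
    have "((\<alpha> \<circ> uminus) has_vector_derivative (- 1) *\<^sub>R f (\<alpha> (- t))) (at t)"
      using that by (intro vector_diff_chain_at) (auto intro!: derivative_eq_intros)
    then show ?thesis by (simp add: o_def)
  qed
  have "\<exists>C. C-lipschitz_on S (\<lambda>x. - f x)" if "bounded S" for S
    using lip[OF that] by (auto intro: lipschitz_on_minus)
  then have "\<gamma> (- (- T)) = \<delta> (- (- T))"
  proof (rule ode_unique_forward[where f = "\<lambda>x. - f x" and \<gamma> = "\<lambda>t. \<gamma> (- t)" and \<delta> = "\<lambda>t. \<delta> (- t)"])
    fix t assume "0 \<le> t" "t \<le> - T"
    then show "((\<lambda>t. \<gamma> (- t)) has_vector_derivative - f (\<gamma> (- t))) (at t)"
      and "((\<lambda>t. \<delta> (- t)) has_vector_derivative - f (\<delta> (- t))) (at t)"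
      by (blast intro: reflect[OF \<gamma>[OF I]] reflect[OF \<delta>[OF I]])+
  qed (use False assms(7) in simp_all)
  then show ?thesis by simp
qed

text \<open>The quadratic part telescopes: B x x - B y y = B (x - y) x + B y (x - y). On a ball of
  radius R this costs 2 R b, with b a bound of \<open>B\<close>.\<close>

lemma bilinear_field_locally_lipschitz:
  assumes A: "bounded_linear A" and B: "bounded_bilinear B" and "bounded S"
  shows "\<exists>C. C-lipschitz_on S (\<lambda>x. A x + B x x)"
proof -
  interpret B: bounded_bilinear B by fact
  obtain a where a: "\<And>x. norm (A x) \<le> norm x * a" "a \<ge> 0"
    using bounded_linear.nonneg_bounded[OF A] by blast
  obtain b where b: "\<And>x y. norm (B x y) \<le> norm x * norm y * b" "b \<ge> 0"
    using B.nonneg_bounded by blast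
  obtain R where R: "\<And>x. x \<in> S \<Longrightarrow> norm x \<le> R" "R > 0"
    using \<open>bounded S\<close> by (auto simp: bounded_pos)
  have "(a + 2 * R * b)-lipschitz_on S (\<lambda>x. A x + B x x)"
  proof (rule lipschitz_onI)
    fix x y assume xy: "x \<in> S" "y \<in> S"
    have "A x + B x x - (A y + B y y) = A (x - y) + (B (x - y) x + B y (x - y))"
      by (simp add: B.diff_left B.diff_right linear_diff[OF bounded_linear.linear[OF A]])
    also have "norm \<dots> \<le> norm (x - y) * a + (norm (x - y) * norm x * b + norm y * norm (x - y) * b)"
      using a(1)[of "x - y"] b(1)[of "x - y" x] b(1)[of y "x - y"]
        norm_triangle_ineq[of "A (x - y)" "B (x - y) x + B y (x - y)"]
        norm_triangle_ineq[of "B (x - y) x" "B y (x - y)"]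
      by linarith
    also have "\<dots> \<le> norm (x - y) * a + (norm (x - y) * R * b + R * norm (x - y) * b)"
      using R(1)[OF xy(1)] R(1)[OF xy(2)] b(2) by (intro add_mono mult_right_mono mult_left_mono) simp_all
    finally show "dist (A x + B x x) (A y + B y y) \<le> (a + 2 * R * b) * dist x y"
      by (simp add: dist_norm algebra_simps)
  qed (use a(2) b(2) R(2) in simp)
  then show ?thesis by blast
qed

section \<open>Meridians and the pendulum\<close>

text \<open>Linear in (s, z, \<rho>) for fixed \<phi>, so the same map describes points and
  velocities. The sphere direction is (cos \<phi>, sin \<phi>) turned by - \<pi>/2. Both s and
  \<rho> are signed.\<close>

definition meridian :: "real \<Rightarrow> real \<Rightarrow> real \<Rightarrow> real \<Rightarrow> state" where
  "meridian \<phi> s z \<rho> = s *\<^sub>R (vector [sin \<phi>, - cos \<phi>, 0], 0) + z *\<^sub>R north + \<rho> *\<^sub>R (0, vector [cos \<phi>, sin \<phi>])"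

lemma meridian_nth [simp]:
  "fst (meridian \<phi> s z \<rho>) $ 1 = s * sin \<phi>" "fst (meridian \<phi> s z \<rho>) $ 2 = - (s * cos \<phi>)"
  "fst (meridian \<phi> s z \<rho>) $ 3 = z"
  "snd (meridian \<phi> s z \<rho>) $ 1 = \<rho> * cos \<phi>" "snd (meridian \<phi> s z \<rho>) $ 2 = \<rho> * sin \<phi>"
  by (simp_all add: meridian_def north_def vector_3 vector_2)

lemma state_eq_iff:
  fixes p q :: state
  shows "p = q \<longleftrightarrow> fst p $ 1 = fst q $ 1 \<and> fst p $ 2 = fst q $ 2 \<and> fst p $ 3 = fst q $ 3 \<and>
    snd p $ 1 = snd q $ 1 \<and> snd p $ 2 = snd q $ 2"
  by (auto simp: prod_eq_iff vec_eq_iff forall_3 forall_2)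

lemma H_meridian [simp]: "H (meridian \<phi> s z \<rho>) = 0"
  by (simp add: H_def)

lemma L_meridian: "L lam mu (meridian \<phi> s z \<rho>) = mu * \<rho>\<^sup>2 / 2 + lam * (z - 1)"
proof -
  have "(\<rho> * cos \<phi>)\<^sup>2 + (\<rho> * sin \<phi>)\<^sup>2 = \<rho>\<^sup>2"
    using sin_cos_squared_add2[of \<phi>] by algebra
  then show ?thesis by (simp add: L_def)
qed

lemma meridian_phase_space [simp]: "meridian \<phi> s z \<rho> \<in> phase_space \<longleftrightarrow> s\<^sup>2 + z\<^sup>2 = 1"
proof -
  have "(s * sin \<phi>)\<^sup>2 + (- (s * cos \<phi>))\<^sup>2 = s\<^sup>2"
    using sin_cos_squared_add2[of \<phi>] by algebra
  then show ?thesis by (simp add: phase_space_iff)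
qed

lemma xy_meridian: "xy (meridian \<phi> s z \<rho>) = of_real s * cis (\<phi> - pi / 2)"
  by (simp add: xy_def complex_eq_iff cos_diff sin_diff)

lemma uv_meridian: "uv (meridian \<phi> s z \<rho>) = of_real \<rho> * cis \<phi>"
  by (simp add: uv_def complex_eq_iff)

lemma meridian_poles: "meridian \<phi> 0 1 0 = north" "meridian \<phi> 0 (- 1) 0 = south"
  by (simp_all add: state_eq_iff north_def south_def vector_3)

lemma poles_iff:
  assumes "p \<in> phase_space"
  shows "p \<in> {north, south} \<longleftrightarrow> uv p = 0 \<and> xy p = 0"
proof -
  have "fst p $ 3 = 1 \<or> fst p $ 3 = - 1" if "fst p $ 1 = 0" "fst p $ 2 = 0"
    using assms that by (simp add: phase_space_iff power2_eq_1_iff)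
  then show ?thesis
    by (auto simp: state_eq_iff north_def south_def uv_def xy_def vector_3 complex_eq_iff)
qed

text \<open>If (u, v) is nonzero it determines \<phi>, and H = 0 makes (x, y) a signed multiple of
  the orthogonal direction. Otherwise (x, y) determines \<phi>, with any \<phi> admissible at the
  poles. The sign of \<rho> is normalized so that later square roots return \<rho> itself.\<close>

lemma zero_level_meridian:
  assumes "p \<in> zero_level"
  obtains \<phi> s z \<rho> where "p = meridian \<phi> s z \<rho>" "s\<^sup>2 + z\<^sup>2 = 1" "\<rho> \<ge> 0"
proof -
  define x y z u v where "x = fst p $ 1" and "y = fst p $ 2" and "z = fst p $ 3"
    and "u = snd p $ 1" and "v = snd p $ 2"
  note d = x_def y_def z_def u_def v_def
  have "\<exists>\<phi> s \<rho>. p = meridian \<phi> s z \<rho> \<and> \<rho> \<ge> 0"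
  proof (cases "uv p = 0")
    case True
    define \<phi> where "\<phi> = Arg (xy p) + pi / 2"
    have "xy p = of_real (cmod (xy p)) * cis (\<phi> - pi / 2)"
      using cis_Arg_eq[of "xy p"] by (cases "xy p = 0") (simp_all add: \<phi>_def)
    then have "xy p = xy (meridian \<phi> (cmod (xy p)) z 0)"
      by (simp add: xy_meridian)
    moreover have "uv p = uv (meridian \<phi> (cmod (xy p)) z 0)"
      using True by (simp add: uv_meridian)
    ultimately have "p = meridian \<phi> (cmod (xy p)) z 0"
      by (simp add: state_eq_iff xy_def uv_def d)
    then show ?thesis by blast
  next
    case False
    define \<phi> where "\<phi> = Arg (uv p)"
    define \<rho> where "\<rho> = cmod (uv p)"
    have "uv p = of_real \<rho> * cis \<phi>"
      using cis_Arg_eq[OF False] by (simp add: \<phi>_def \<rho>_def)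
    then have uv: "u = \<rho> * cos \<phi>" "v = \<rho> * sin \<phi>"
      by (simp_all add: uv_def complex_eq_iff d)
    have "\<rho> > 0" using False by (simp add: \<rho>_def)
    have "\<rho> * (x * cos \<phi> + y * sin \<phi>) = 0"
      using assms uv by (simp add: zero_level_def H_def d algebra_simps)
    then have orth: "x * cos \<phi> + y * sin \<phi> = 0"
      using \<open>\<rho> > 0\<close> by simp
    define s where "s = x * sin \<phi> - y * cos \<phi>"
    have "x = s * sin \<phi>" "y = - (s * cos \<phi>)"
      using orth sin_cos_squared_add[of \<phi>] unfolding s_def by algebra+
    then have "p = meridian \<phi> s z \<rho>"
      using uv by (simp add: state_eq_iff d)
    then show ?thesis using \<open>\<rho> > 0\<close> less_imp_le by blast
  qed
  then obtain \<phi> s \<rho> where p: "p = meridian \<phi> s z \<rho>" "\<rho> \<ge> 0" by blast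
  moreover have "s\<^sup>2 + z\<^sup>2 = 1"
    using assms p(1) by (simp add: zero_level_def)
  ultimately show thesis using that by blast
qed

text \<open>On a meridian the flow of \<open>H\<close> is a pendulum: with \<open>s = sin \<theta>\<close> and \<open>z = cos \<theta>\<close> the equations
  read \<open>\<theta>' = \<rho> / (2 lam)\<close> and \<open>\<rho>' = sin \<theta> / (2 mu)\<close>.\<close>

definition pendulum :: "real \<Rightarrow> real \<Rightarrow> (real \<Rightarrow> real) \<Rightarrow> (real \<Rightarrow> real) \<Rightarrow> (real \<Rightarrow> real) \<Rightarrow> bool" where
  "pendulum lam mu s z \<rho> \<longleftrightarrow> (\<forall>t. (s t)\<^sup>2 + (z t)\<^sup>2 = 1 \<and>
     (s has_real_derivative \<rho> t * z t / (2 * lam)) (at t) \<and>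
     (z has_real_derivative - (\<rho> t * s t / (2 * lam))) (at t) \<and>
     (\<rho> has_real_derivative s t / (2 * mu)) (at t))"

text \<open>The velocity lies in the linear span with the same \<phi>: this is why \<phi> is
  conserved.\<close>

lemma H_field_meridian:
  "H_field lam mu (meridian \<phi> s z \<rho>) = meridian \<phi> (\<rho> * z / (2 * lam)) (- (\<rho> * s / (2 * lam))) (s / (2 * mu))"
proof -
  have *: "\<rho> * cos \<phi> * (s * cos \<phi>) + \<rho> * sin \<phi> * (s * sin \<phi>) = \<rho> * s"
    using sin_cos_squared_add[of \<phi>] by algebra
  have "- (\<rho> * cos \<phi> * (s * cos \<phi>)) - \<rho> * sin \<phi> * (s * sin \<phi>) = - (\<rho> * s)"
    using * by linarith
  then show ?thesis
    by (simp add: state_eq_iff H_field_def vector_3 vector_2 mult_ac)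
qed

lemma pendulum_integral_curve:
  assumes "lam > 0" "mu > 0" "pendulum lam mu s z \<rho>"
  shows "integral_curve lam mu H UNIV (\<lambda>t. meridian \<phi> (s t) (z t) (\<rho> t))"
  unfolding integral_curve_def
proof (intro ballI conjI)
  fix t
  have d: "(s has_real_derivative \<rho> t * z t / (2 * lam)) (at t)"
    "(z has_real_derivative - (\<rho> t * s t / (2 * lam))) (at t)"
    "(\<rho> has_real_derivative s t / (2 * mu)) (at t)"
    using assms(3) by (simp_all add: pendulum_def)
  show mem: "meridian \<phi> (s t) (z t) (\<rho> t) \<in> phase_space"
    using assms(3) by (simp add: pendulum_def)
  show "((\<lambda>t. meridian \<phi> (s t) (z t) (\<rho> t)) has_vector_derivative
      ham_vf lam mu H (meridian \<phi> (s t) (z t) (\<rho> t))) (at t)"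
    unfolding ham_vf_H[OF assms(1,2) mem] H_field_meridian
    unfolding meridian_def
    by (auto intro!: derivative_eq_intros d simp: has_real_derivative_iff_has_vector_derivative[symmetric])
qed

lemma H_field_lipschitz:
  assumes "bounded S"
  shows "\<exists>C. C-lipschitz_on S (H_field lam mu)"
proof -
  define A :: "state \<Rightarrow> state" where
    "A = (\<lambda>p. (0, (1 / (2 * mu)) *\<^sub>R vector [- (fst p $ 2), fst p $ 1]))"
  define B :: "state \<Rightarrow> state \<Rightarrow> state" where
    "B = (\<lambda>p q. ((1 / (2 * lam)) *\<^sub>R vector [snd p $ 2 * fst q $ 3, - (snd p $ 1 * fst q $ 3),
        snd p $ 1 * fst q $ 2 - snd p $ 2 * fst q $ 1], 0))"
  have "bounded_linear A"
    unfolding linear_conv_bounded_linear[symmetric]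
    by (rule linearI) (simp_all add: state_eq_iff A_def vector_2 add_divide_distrib diff_divide_distrib)
  moreover have "bounded_bilinear B"
    unfolding bilinear_conv_bounded_bilinear[symmetric] bilinear_def
    by (intro conjI allI linearI) (simp_all add: state_eq_iff B_def vector_3 add_divide_distrib diff_divide_distrib algebra_simps)
  ultimately have "\<exists>C. C-lipschitz_on S (\<lambda>p. A p + B p p)"
    using assms by (rule bilinear_field_locally_lipschitz)
  moreover have "A p + B p p = H_field lam mu p" for p
    by (simp add: A_def B_def H_field_def)
  ultimately show ?thesis by simp
qed

lemma orbit_eq_range:
  assumes "lam > 0" "mu > 0" and \<gamma>: "integral_curve lam mu H UNIV \<gamma>" and "\<gamma> 0 = p"
  shows "orbit lam mu H p = range \<gamma>"
proof
  show "range \<gamma> \<subseteq> orbit lam mu H p"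
    using assms by (auto simp: orbit_def intro!: exI[of _ \<gamma>] exI[of _ UNIV])
  show "orbit lam mu H p \<subseteq> range \<gamma>"
  proof
    fix q assume "q \<in> orbit lam mu H p"
    then obtain \<delta> I t where *: "open I" "is_interval I" "0 \<in> I" "t \<in> I" "\<delta> 0 = p"
      "integral_curve lam mu H I \<delta>" "q = \<delta> t"
      by (auto simp: orbit_def)
    have "\<delta> t = \<gamma> t"
    proof (rule ode_unique[where f = "H_field lam mu" and I = I])
      show "(\<delta> has_vector_derivative H_field lam mu (\<delta> t)) (at t)" if "t \<in> I" for t
        using *(6) that at_within_open[OF that *(1)] ham_vf_H[OF assms(1,2)]
        unfolding integral_curve_def by metis
      show "(\<gamma> has_vector_derivative H_field lam mu (\<gamma> t)) (at t)" for t
        using \<gamma> ham_vf_H[OF assms(1,2)] unfolding integral_curve_def by (metis UNIV_I)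
    qed (use * assms(4) H_field_lipschitz in auto)
    then show "q \<in> range \<gamma>" using *(7) by simp
  qed
qed

lemma complete_curve_pendulum:
  assumes "lam > 0" "mu > 0" "pendulum lam mu s z \<rho>"
  shows "complete_curve_of lam mu H (meridian \<phi> (s 0) (z 0) (\<rho> 0)) (\<lambda>t. meridian \<phi> (s t) (z t) (\<rho> t))"
  using pendulum_integral_curve[OF assms] orbit_eq_range[OF assms(1,2)]
  unfolding complete_curve_of_def by blast

lemma pendulum_rotation:
  assumes "lam > 0" "mu > 0" and init: "s0\<^sup>2 + z0\<^sup>2 = 1" "\<rho>0 \<ge> 0"
    and E: "E = mu * \<rho>0\<^sup>2 / 2 + lam * (z0 - 1)" "E > 0"
  obtains s z \<rho> T where "pendulum lam mu s z \<rho>" "s 0 = s0" "z 0 = z0" "\<rho> 0 = \<rho>0"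
    "\<And>t. \<rho> t \<noteq> 0" "T > 0" "\<And>t. s (t + T) = s t \<and> z (t + T) = z t \<and> \<rho> (t + T) = \<rho> t"
proof -
  define R where "R = (\<lambda>\<theta>. 2 * (E + lam * (1 - cos \<theta>)) / mu)"
  have R: "R \<theta> > 0" for \<theta>
    using assms by (simp add: R_def add_pos_nonneg)
  obtain \<theta>0 where \<theta>0: "z0 = cos \<theta>0" "s0 = sin \<theta>0"
    using sincos_total_2pi[of z0 s0] init by (auto simp: add.commute)
  have "continuous_on UNIV (\<lambda>\<theta>. sqrt (R \<theta>) / (2 * lam))"
    unfolding R_def using assms by (intro continuous_intros) auto
  then obtain \<theta> T where \<theta>: "\<theta> 0 = \<theta>0" "T > 0"
    "\<And>t. (\<theta> has_real_derivative sqrt (R (\<theta> t)) / (2 * lam)) (at t)" "\<And>t. \<theta> (t + T) = \<theta> t + 2 * pi"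
    using R assms by (elim autonomous_ode_periodic[of _ "2 * pi" \<theta>0]) (auto simp: R_def)
  show thesis
  proof
    show "pendulum lam mu (\<lambda>t. sin (\<theta> t)) (\<lambda>t. cos (\<theta> t)) (\<lambda>t. sqrt (R (\<theta> t)))"
      unfolding pendulum_def
    proof (intro allI conjI)
      fix t
      have R': "((\<lambda>t. R (\<theta> t)) has_real_derivative
          2 * lam * sin (\<theta> t) / mu * (sqrt (R (\<theta> t)) / (2 * lam))) (at t)"
        unfolding R_def using assms
        by (auto intro!: derivative_eq_intros \<theta>(3)[unfolded R_def] simp: field_simps)
      show "((\<lambda>t. sqrt (R (\<theta> t))) has_real_derivative sin (\<theta> t) / (2 * mu)) (at t)"
        using R[of "\<theta> t"] assms
        by (auto intro!: derivative_eq_intros R' simp: field_simps)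
    qed (auto intro!: derivative_eq_intros \<theta>(3))
    show "sin (\<theta> 0) = s0" "cos (\<theta> 0) = z0"
      using \<theta>0 \<theta>(1) by auto
    show "sqrt (R (\<theta> 0)) = \<rho>0"
    proof -
      have "R (\<theta> 0) = \<rho>0\<^sup>2"
        using assms by (simp add: R_def \<theta>(1) \<theta>0(1)[symmetric] field_simps)
      then show ?thesis using init by simp
    qed
    show "sqrt (R (\<theta> t)) \<noteq> 0" for t
      using R[of "\<theta> t"] by simp
    show "sin (\<theta> (t + T)) = sin (\<theta> t) \<and> cos (\<theta> (t + T)) = cos (\<theta> t) \<and> sqrt (R (\<theta> (t + T))) = sqrt (R (\<theta> t))" for t
      by (simp add: \<theta>(4) R_def)
  qed (fact \<theta>(2))
qed

text \<open>Librations are uniformized by Jacobi's amplitude \<open>\<psi>\<close>: with \<open>\<theta> = \<pi> + \<beta>\<close> and modulus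
  \<open>k\<^sup>2 = (E + 2 lam) / (2 lam)\<close>, put \<open>sin (\<beta> / 2) = k sin \<psi>\<close>. This removes the turning points,
  as \<open>\<psi>' = sqrt (1 - k\<^sup>2 sin\<^sup>2 \<psi>) / (mu A)\<close> never vanishes.\<close>

lemma pendulum_libration:
  assumes "lam > 0" "mu > 0" and init: "s0\<^sup>2 + z0\<^sup>2 = 1" "s0 \<noteq> 0 \<or> \<rho>0 \<noteq> 0"
    and E: "E = mu * \<rho>0\<^sup>2 / 2 + lam * (z0 - 1)" "E < 0"
  obtains s z \<rho> T where "pendulum lam mu s z \<rho>" "s 0 = s0" "z 0 = z0" "\<rho> 0 = \<rho>0"
    "\<And>t. s t \<noteq> 0 \<or> \<rho> t \<noteq> 0" "T > 0" "\<And>t. s (t + T) = s t \<and> z (t + T) = z t \<and> \<rho> (t + T) = \<rho> t"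
proof -
  define A where "A = 2 * sqrt (lam / mu)"
  have A: "A > 0" "mu * A\<^sup>2 = 4 * lam"
    using assms by (simp_all add: A_def power_mult_distrib)
  have z0: "-1 \<le> z0" "z0 < 1"
  proof -
    have "z0\<^sup>2 \<le> 1" using init(1) zero_le_power2[of s0] by linarith
    then show "-1 \<le> z0" by (simp add: abs_square_le_1 abs_le_iff)
    have "mu * \<rho>0\<^sup>2 / 2 \<ge> 0" using assms by simp
    then have "lam * (z0 - 1) < 0" using E by linarith
    then show "z0 < 1" using assms by (simp add: mult_less_0_iff)
  qed
  define k where "k = sqrt ((E + 2 * lam) / (2 * lam))"
  \<comment> \<open>Kinetic plus potential energy above the bottom, in units of 2 lam. It is
    positive because the initial point is not the equilibrium at the bottom, and below 1 because E <
    0.\<close>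
  have K: "(E + 2 * lam) / (2 * lam) = \<rho>0\<^sup>2 / A\<^sup>2 + (z0 + 1) / 2"
  proof -
    have "mu * \<rho>0\<^sup>2 / (4 * lam) = \<rho>0\<^sup>2 / A\<^sup>2"
      using assms A(1) by (simp add: A(2)[symmetric])
    moreover have "(E + 2 * lam) / (2 * lam) = mu * \<rho>0\<^sup>2 / (4 * lam) + (z0 + 1) / 2"
      using assms by (simp add: E field_simps)
    ultimately show ?thesis by simp
  qed
  have "\<rho>0\<^sup>2 / A\<^sup>2 + (z0 + 1) / 2 > 0"
  proof (cases "\<rho>0 = 0")
    case True
    then have "z0 \<noteq> -1" using init by auto
    then show ?thesis using True z0 by simp
  next
    case False
    then show ?thesis using A(1) z0 by (intro add_pos_nonneg) simp_all
  qed
  then have k: "k > 0" "k\<^sup>2 = \<rho>0\<^sup>2 / A\<^sup>2 + (z0 + 1) / 2" "k\<^sup>2 < 1"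
    using E(2) assms(1) by (simp_all add: k_def K[symmetric]) 
  define \<Delta> where "\<Delta> = (\<lambda>\<psi>. sqrt (1 - k\<^sup>2 * (sin \<psi>)\<^sup>2))"
  have pos: "1 - k\<^sup>2 * (sin \<psi>)\<^sup>2 > 0" for \<psi>
  proof -
    have "k\<^sup>2 * (sin \<psi>)\<^sup>2 \<le> k\<^sup>2 * 1"
      by (intro mult_left_mono) (simp_all add: abs_square_le_1)
    then show ?thesis using k(3) by linarith
  qed
  then have \<Delta>: "\<Delta> \<psi> > 0" "(\<Delta> \<psi>)\<^sup>2 = 1 - k\<^sup>2 * (sin \<psi>)\<^sup>2" for \<psi>
    by (simp_all add: \<Delta>_def less_imp_le)
  define d where "d = sqrt ((1 - z0) / 2)"
  have d: "d > 0" "d\<^sup>2 = (1 - z0) / 2"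
    using z0 by (simp_all add: d_def)
  \<comment> \<open>The formulas for \<rho> and s are solved for cos \<psi>0 and sin \<psi>0, with
    \<open>d\<close> the value of \<Delta> at \<psi>0. Using both fixes the quadrant of
    \<psi>0.\<close>
  have "(\<rho>0 / (A * k))\<^sup>2 + (- s0 / (2 * k * d))\<^sup>2 = 1"
  proof -
    have "(- s0 / (2 * k * d))\<^sup>2 = (1 - z0\<^sup>2) / (4 * k\<^sup>2 * ((1 - z0) / 2))"
      using init by (simp add: power_divide power_mult_distrib d(2)[symmetric] eq_diff_eq)
    also have "\<dots> = (1 + z0) / 2 / k\<^sup>2"
      using z0(2) k(1) by (simp add: divide_simps) (simp add: power2_eq_square algebra_simps)
    finally have "(\<rho>0 / (A * k))\<^sup>2 + (- s0 / (2 * k * d))\<^sup>2 = (\<rho>0\<^sup>2 / A\<^sup>2 + (z0 + 1) / 2) / k\<^sup>2"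
      by (simp add: power_divide power_mult_distrib add_divide_distrib add.commute)
    then show ?thesis using k(1) unfolding k(2)[symmetric] by simp
  qed
  then obtain \<psi>0 where \<psi>0: "\<rho>0 / (A * k) = cos \<psi>0" "- s0 / (2 * k * d) = sin \<psi>0"
    using sincos_total_2pi by blast
  have kn: "k\<^sup>2 * (sin \<psi>0)\<^sup>2 = (1 + z0) / 2"
  proof -
    have "k\<^sup>2 * (sin \<psi>0)\<^sup>2 = (1 - z0\<^sup>2) / (4 * d\<^sup>2)"
      using k(1) init(1) by (simp add: \<psi>0(2)[symmetric] power_divide power_mult_distrib eq_diff_eq)
    also have "\<dots> = (1 + z0) / 2"
      using z0(2) unfolding d(2) by (simp add: divide_simps) (simp add: power2_eq_square algebra_simps)
    finally show ?thesis .
  qed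
  have "continuous_on UNIV (\<lambda>\<psi>. \<Delta> \<psi> / (mu * A))"
    unfolding \<Delta>_def using assms A by (intro continuous_intros) auto
  then obtain \<psi> T where \<psi>: "\<psi> 0 = \<psi>0" "T > 0"
    "\<And>t. (\<psi> has_real_derivative \<Delta> (\<psi> t) / (mu * A)) (at t)" "\<And>t. \<psi> (t + T) = \<psi> t + 2 * pi"
    using \<Delta>(1) assms A by (elim autonomous_ode_periodic[of _ "2 * pi" \<psi>0]) (auto simp: \<Delta>_def)
  define s where "s = (\<lambda>t. - (2 * k * sin (\<psi> t) * \<Delta> (\<psi> t)))"
  define z where "z = (\<lambda>t. 2 * k\<^sup>2 * (sin (\<psi> t))\<^sup>2 - 1)"
  define \<rho> where "\<rho> = (\<lambda>t. A * k * cos (\<psi> t))"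
  have mu: "mu * A = 4 * lam / A"
    using A by (simp add: field_simps power2_eq_square)
  show thesis
  proof
    show "pendulum lam mu s z \<rho>"
      unfolding pendulum_def
    proof (intro allI conjI)
      fix t
      define S C D where "S = sin (\<psi> t)" and "C = cos (\<psi> t)" and "D = \<Delta> (\<psi> t)"
      have D: "D > 0" "D\<^sup>2 = 1 - k\<^sup>2 * S\<^sup>2"
        using \<Delta> by (simp_all add: D_def S_def)
      show "(s t)\<^sup>2 + (z t)\<^sup>2 = 1"
        unfolding s_def z_def D_def[symmetric] S_def[symmetric] using D(2) by algebra
      have \<psi>': "(\<psi> has_real_derivative D / (mu * A)) (at t)"
        unfolding D_def by (rule \<psi>(3))
      have \<Delta>': "((\<lambda>t. 1 - k\<^sup>2 * (sin (\<psi> t))\<^sup>2) has_real_derivative - (2 * k\<^sup>2 * S * (C * (D / (mu * A))))) (at t)"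
        by (auto intro!: derivative_eq_intros \<psi>' simp: S_def C_def)
      have D': "((\<lambda>t. \<Delta> (\<psi> t)) has_real_derivative - (k\<^sup>2 * S * C / (mu * A))) (at t)"
        unfolding \<Delta>_def
        by (rule DERIV_cong[OF DERIV_chain2[where f = sqrt, OF DERIV_real_sqrt[OF pos] \<Delta>']])
          (use D(1) in \<open>simp add: D_def[unfolded \<Delta>_def, symmetric]\<close>)
      show "(\<rho> has_real_derivative s t / (2 * mu)) (at t)"
        unfolding \<rho>_def using A(1) assms(2)
        by (auto intro!: derivative_eq_intros \<psi>' simp: s_def S_def D_def field_simps)
      show "(z has_real_derivative - (\<rho> t * s t / (2 * lam))) (at t)"
      proof -
        have "(z has_real_derivative 4 * k\<^sup>2 * S * (C * (D / (4 * lam / A)))) (at t)"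
          unfolding z_def mu[symmetric] by (auto intro!: derivative_eq_intros \<psi>' simp: S_def C_def)
        then show ?thesis
          by (rule DERIV_cong) (simp add: s_def \<rho>_def S_def D_def C_def power2_eq_square)
      qed
      show "(s has_real_derivative \<rho> t * z t / (2 * lam)) (at t)"
      proof -
        have "(s has_real_derivative
            - (2 * k * (C * (D / (mu * A)) * D + S * (- (k\<^sup>2 * S * C / (mu * A)))))) (at t)"
          unfolding s_def by (auto intro!: derivative_eq_intros \<psi>' D' simp: S_def C_def D_def algebra_simps)
        then show ?thesis
        proof (rule DERIV_cong)
          have "C * (D / (mu * A)) * D + S * (- (k\<^sup>2 * S * C / (mu * A))) = C * (D\<^sup>2 - k\<^sup>2 * S\<^sup>2) / (mu * A)"
            by (simp add: diff_divide_distrib power2_eq_square algebra_simps)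
          also have "\<dots> = - C * z t * A / (4 * lam)"
            unfolding D(2) mu by (simp add: z_def S_def algebra_simps)
          finally have *: "C * (D / (mu * A)) * D + S * (- (k\<^sup>2 * S * C / (mu * A))) = - C * z t * A / (4 * lam)" .
          show "- (2 * k * (C * (D / (mu * A)) * D + S * (- (k\<^sup>2 * S * C / (mu * A))))) = \<rho> t * z t / (2 * lam)"
            unfolding * using assms(1) by (simp add: \<rho>_def C_def field_simps)
        qed
      qed
    qed
    show "z 0 = z0" using kn by (simp add: z_def \<psi>(1))
    show "\<rho> 0 = \<rho>0" using A(1) k(1) by (simp add: \<rho>_def \<psi>(1) \<psi>0(1)[symmetric])
    show "s 0 = s0"
    proof -
      have "\<Delta> \<psi>0 = d" unfolding \<Delta>_def kn d_def by (simp add: field_simps)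
      then show ?thesis using k(1) d(1) by (simp add: s_def \<psi>(1) \<psi>0(2)[symmetric])
    qed
    show "s t \<noteq> 0 \<or> \<rho> t \<noteq> 0" for t
    proof -
      have "sin (\<psi> t) \<noteq> 0 \<or> cos (\<psi> t) \<noteq> 0"
        using sin_zero_abs_cos_one[of "\<psi> t"] by auto
      then show ?thesis
        using \<Delta>(1)[of "\<psi> t"] A(1) k(1) by (auto simp: s_def \<rho>_def)
    qed
    show "s (t + T) = s t \<and> z (t + T) = z t \<and> \<rho> (t + T) = \<rho> t" for t
      by (simp add: s_def z_def \<rho>_def \<Delta>_def \<psi>(4))
  qed (fact \<psi>(2))
qed

text \<open>With \<beta> the angle from the bottom, cos (\<beta> / 2) = 1 / cosh \<tau> and sin
  (\<beta> / 2) = tanh \<tau>. This covers the circle without its top point; it supplies both the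
  initial time of a separatrix and the fact that no other point is missed.\<close>

lemma separatrix_parameter:
  fixes s z :: real
  assumes "s\<^sup>2 + z\<^sup>2 = 1" "z \<noteq> 1"
  obtains \<tau> where "s = - (2 * sinh \<tau> / (cosh \<tau>)\<^sup>2)" "z = 1 - 2 / (cosh \<tau>)\<^sup>2"
    "sqrt ((1 - z) / 2) = 1 / cosh \<tau>"
proof -
  have "z\<^sup>2 \<le> 1" using assms(1) zero_le_power2[of s] by linarith
  then have "z < 1" using assms(2) by (simp add: abs_square_le_1 abs_le_iff)
  define m where "m = sqrt ((1 - z) / 2)"
  have m: "m > 0" "m\<^sup>2 = (1 - z) / 2"
    using \<open>z < 1\<close> by (simp_all add: m_def)
  define \<tau> where "\<tau> = arsinh (- s / (2 * m\<^sup>2))"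
  have "(- s / (2 * m\<^sup>2))\<^sup>2 + 1 = (1 / m)\<^sup>2"
  proof -
    have "s\<^sup>2 = (1 - z) * (1 + z)"
      using assms(1) by (simp add: power2_eq_square algebra_simps)
    then have "s\<^sup>2 + 4 * (m\<^sup>2)\<^sup>2 = 4 * m\<^sup>2"
      unfolding m(2) by (simp add: power2_eq_square field_simps)
    moreover have "(- s / (2 * m\<^sup>2))\<^sup>2 + 1 = (s\<^sup>2 + 4 * (m\<^sup>2)\<^sup>2) / (4 * (m\<^sup>2)\<^sup>2)"
      using m(1) by (simp add: power_divide add_divide_distrib)
    ultimately show ?thesis
      using m(1) by (simp add: power2_eq_square)
  qed
  then have c: "cosh \<tau> = 1 / m"
    using m(1) unfolding \<tau>_def cosh_arsinh_real by (simp add: real_sqrt_unique)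
  have "sinh \<tau> = - s / (2 * m\<^sup>2)"
    unfolding \<tau>_def by (rule sinh_arsinh_real)
  then have "s = - (2 * sinh \<tau> * m\<^sup>2)"
    using m(1) by simp
  moreover have "z = 1 - 2 * m\<^sup>2"
    using m(2) by simp
  moreover have "sqrt ((1 - z) / 2) = 1 / cosh \<tau>"
    by (simp add: c m_def)
  ultimately show thesis
    by (intro that[of \<tau>]) (simp_all add: c power_divide)
qed

text \<open>The limit k = 1 of the librations: \<psi>' = cos \<psi> / (mu A) is solved by sin \<psi>
  = tanh \<tau>, cos \<psi> = 1 / cosh \<tau>, with \<tau> of slope 1 / (mu A).\<close>

lemma pendulum_separatrix:
  fixes lam mu A \<tau>0 :: real
  assumes "lam > 0" "mu > 0" "A > 0" "mu * A\<^sup>2 = 4 * lam"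
  defines "\<tau> \<equiv> \<lambda>t. t / (mu * A) + \<tau>0"
  shows "pendulum lam mu (\<lambda>t. - (2 * sinh (\<tau> t) / (cosh (\<tau> t))\<^sup>2)) (\<lambda>t. 1 - 2 / (cosh (\<tau> t))\<^sup>2)
    (\<lambda>t. A * (1 / cosh (\<tau> t)))"
  unfolding pendulum_def
proof (intro allI conjI)
  fix t
  define S C where "S = sinh (\<tau> t)" and "C = cosh (\<tau> t)"
  have C: "C > 0" "C\<^sup>2 = S\<^sup>2 + 1"
    by (simp_all add: C_def S_def cosh_square_eq)
  have mu: "1 / (mu * A) = A / (4 * lam)"
    using assms(1-4) by (simp add: divide_simps power2_eq_square mult.left_commute)
  show "(- (2 * S / C\<^sup>2))\<^sup>2 + (1 - 2 / C\<^sup>2)\<^sup>2 = 1"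
    using C(1) by (simp add: divide_simps) (use C(2) in algebra)
  have \<tau>': "(\<tau> has_real_derivative 1 / (mu * A)) (at t)"
    unfolding \<tau>_def using assms by (auto intro!: derivative_eq_intros)
  show "((\<lambda>t. A * (1 / cosh (\<tau> t))) has_real_derivative - (2 * S / C\<^sup>2) / (2 * mu)) (at t)"
    using C(1) assms(2,3)
    by (auto intro!: derivative_eq_intros \<tau>' simp: C_def[symmetric] S_def[symmetric] divide_simps power2_eq_square)
  show "((\<lambda>t. 1 - 2 / (cosh (\<tau> t))\<^sup>2) has_real_derivative
      - (A * (1 / C) * (- (2 * S / C\<^sup>2)) / (2 * lam))) (at t)"
    using C(1) assms(1)
    by (auto intro!: derivative_eq_intros \<tau>'[unfolded mu] simp: C_def[symmetric] S_def[symmetric] divide_simps power2_eq_square)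
      (simp add: algebra_simps)
  have "((\<lambda>t. - (2 * sinh (\<tau> t) / (cosh (\<tau> t))\<^sup>2)) has_real_derivative
      - (2 * (C * (A / (4 * lam)) * C\<^sup>2 - S * (2 * C * (S * (A / (4 * lam))))) / (C\<^sup>2 * C\<^sup>2))) (at t)"
    using C(1)
    by (auto intro!: derivative_eq_intros \<tau>'[unfolded mu] simp: C_def[symmetric] S_def[symmetric])
  then show "((\<lambda>t. - (2 * sinh (\<tau> t) / (cosh (\<tau> t))\<^sup>2)) has_real_derivative
      A * (1 / C) * (1 - 2 / C\<^sup>2) / (2 * lam)) (at t)"
  proof (rule DERIV_cong)
    have *: "C * (A / (4 * lam)) * C\<^sup>2 - S * (2 * C * (S * (A / (4 * lam)))) = A / (4 * lam) * (C * (2 - C\<^sup>2))"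
      using C(2) by algebra
    show "- (2 * (C * (A / (4 * lam)) * C\<^sup>2 - S * (2 * C * (S * (A / (4 * lam))))) / (C\<^sup>2 * C\<^sup>2)) =
        A * (1 / C) * (1 - 2 / C\<^sup>2) / (2 * lam)"
      unfolding * using C(1) assms(1)
      by (simp add: divide_simps) (simp add: power2_eq_square power4_eq_xxxx algebra_simps)
  qed
qed

section \<open>The zero level of the Hamiltonian\<close>

lemma zero_level_periodic:
  assumes "lam > 0" "mu > 0" and p: "p \<in> zero_level" "uv p \<noteq> 0 \<or> xy p \<noteq> 0" and "L lam mu p \<noteq> 0"
  obtains \<phi> s z \<rho> T where "pendulum lam mu s z \<rho>" "p = meridian \<phi> (s 0) (z 0) (\<rho> 0)"
    "\<And>t. s t \<noteq> 0 \<or> \<rho> t \<noteq> 0" "T > 0"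
    "\<And>t. s (t + T) = s t \<and> z (t + T) = z t \<and> \<rho> (t + T) = \<rho> t"
proof -
  obtain \<phi> s0 z0 \<rho>0 where p_eq: "p = meridian \<phi> s0 z0 \<rho>0" and init: "s0\<^sup>2 + z0\<^sup>2 = 1" "\<rho>0 \<ge> 0"
    using zero_level_meridian[OF p(1)] by blast
  have nz: "s0 \<noteq> 0 \<or> \<rho>0 \<noteq> 0"
    using p(2) by (auto simp: p_eq uv_meridian xy_meridian)
  have E: "L lam mu p = mu * \<rho>0\<^sup>2 / 2 + lam * (z0 - 1)"
    by (simp add: p_eq L_meridian)
  consider "L lam mu p > 0" | "L lam mu p < 0"
    using assms(5) by linarith
  then show thesis
  proof cases
    case 1
    obtain s z \<rho> T where "pendulum lam mu s z \<rho>" "s 0 = s0" "z 0 = z0" "\<rho> 0 = \<rho>0"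
      "\<And>t. \<rho> t \<noteq> 0" "T > 0" "\<And>t. s (t + T) = s t \<and> z (t + T) = z t \<and> \<rho> (t + T) = \<rho> t"
      using pendulum_rotation[OF assms(1,2) init E 1] by blast
    then show thesis
      using that[of s z \<rho> \<phi> T] p_eq by blast
  next
    case 2
    obtain s z \<rho> T where "pendulum lam mu s z \<rho>" "s 0 = s0" "z 0 = z0" "\<rho> 0 = \<rho>0"
      "\<And>t. s t \<noteq> 0 \<or> \<rho> t \<noteq> 0" "T > 0" "\<And>t. s (t + T) = s t \<and> z (t + T) = z t \<and> \<rho> (t + T) = \<rho> t"
      using pendulum_libration[OF assms(1,2) init(1) nz E 2] by blast
    then show thesis
      using that[of s z \<rho> \<phi> T] p_eq by blast
  qed
qed

lemma zero_level_separatrix: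
  assumes "lam > 0" "mu > 0" and p: "p \<in> zero_level" "uv p \<noteq> 0 \<or> xy p \<noteq> 0" and "L lam mu p = 0"
  obtains \<phi> A \<tau>0 where "A > 0" "mu * A\<^sup>2 = 4 * lam"
    "p = meridian \<phi> (- (2 * sinh \<tau>0 / (cosh \<tau>0)\<^sup>2)) (1 - 2 / (cosh \<tau>0)\<^sup>2) (A * (1 / cosh \<tau>0))"
proof -
  obtain \<phi> s0 z0 \<rho>0 where p_eq: "p = meridian \<phi> s0 z0 \<rho>0" and init: "s0\<^sup>2 + z0\<^sup>2 = 1" "\<rho>0 \<ge> 0"
    using zero_level_meridian[OF p(1)] by blast
  have nz: "s0 \<noteq> 0 \<or> \<rho>0 \<noteq> 0"
    using p(2) by (auto simp: p_eq uv_meridian xy_meridian)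
  have E: "mu * \<rho>0\<^sup>2 / 2 + lam * (z0 - 1) = 0"
    using assms(5) by (simp add: p_eq L_meridian)
  define A where "A = 2 * sqrt (lam / mu)"
  have A: "A > 0" "mu * A\<^sup>2 = 4 * lam"
    using assms by (simp_all add: A_def power_mult_distrib)
  have \<rho>0: "mu * \<rho>0\<^sup>2 = 2 * lam * (1 - z0)"
    using E by (simp add: algebra_simps)
  \<comment> \<open>At z0 = 1 the energy leaves \<rho>0 = 0 and the sphere s0 = 0, which is the
    excluded pole.\<close>
  then have "z0 \<noteq> 1" using nz init assms(2) by auto
  then obtain \<tau>0 where \<tau>0: "s0 = - (2 * sinh \<tau>0 / (cosh \<tau>0)\<^sup>2)" "z0 = 1 - 2 / (cosh \<tau>0)\<^sup>2"
    "sqrt ((1 - z0) / 2) = 1 / cosh \<tau>0"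
    using separatrix_parameter[OF init(1)] by blast
  have "mu * \<rho>0\<^sup>2 = mu * (A\<^sup>2 * ((1 - z0) / 2))"
    using \<rho>0 unfolding mult.assoc[symmetric] A(2) by simp
  then have "\<rho>0\<^sup>2 = A\<^sup>2 * ((1 - z0) / 2)"
    using assms(2) by simp
  then have "sqrt (\<rho>0\<^sup>2) = sqrt (A\<^sup>2 * ((1 - z0) / 2))"
    by (rule arg_cong)
  then have "\<rho>0 = A * (1 / cosh \<tau>0)"
    using init(2) A(1) unfolding real_sqrt_mult \<tau>0(3) by simp
  then have "p = meridian \<phi> (- (2 * sinh \<tau>0 / (cosh \<tau>0)\<^sup>2)) (1 - 2 / (cosh \<tau>0)\<^sup>2) (A * (1 / cosh \<tau>0))"
    unfolding p_eq \<tau>0(1)[symmetric] \<tau>0(2)[symmetric] by simp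
  with A show thesis by (rule that)
qed

lemma zero_level_pendulum:
  assumes "lam > 0" "mu > 0" "p \<in> zero_level" "uv p \<noteq> 0 \<or> xy p \<noteq> 0"
  obtains \<phi> s z \<rho> where "pendulum lam mu s z \<rho>" "p = meridian \<phi> (s 0) (z 0) (\<rho> 0)"
    "\<And>t. s t \<noteq> 0 \<or> \<rho> t \<noteq> 0"
proof (cases "L lam mu p = 0")
  case True
  obtain \<phi> A \<tau>0 where A: "A > 0" "mu * A\<^sup>2 = 4 * lam" and
    "p = meridian \<phi> (- (2 * sinh \<tau>0 / (cosh \<tau>0)\<^sup>2)) (1 - 2 / (cosh \<tau>0)\<^sup>2) (A * (1 / cosh \<tau>0))"
    by (rule zero_level_separatrix[OF assms True])
  then show thesis
    by (intro that[OF pendulum_separatrix[OF assms(1,2) A, of \<tau>0], of \<phi>]) simp_all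
next
  case False
  then show thesis
    using zero_level_periodic[OF assms] that by metis
qed

lemma complete_curve_equilibrium:
  assumes "lam > 0" "mu > 0" "p = north \<or> p = south"
  shows "complete_curve_of lam mu H p (\<lambda>_. p)"
proof -
  have "pendulum lam mu (\<lambda>_. 0) (\<lambda>_. z) (\<lambda>_. 0)" if "z\<^sup>2 = 1" for z
    using that by (simp add: pendulum_def)
  from complete_curve_pendulum[OF assms(1,2) this[of 1], of 0]
    complete_curve_pendulum[OF assms(1,2) this[of "- 1"], of 0]
  show ?thesis
    using assms(3) by (auto simp: meridian_poles)
qed

section \<open>The angles on a meridian and their smoothness\<close>

lemma rcong_mod_pi:
  assumes "[a = b] (rmod (2 * pi))"
  shows "[a = b] (rmod pi)"
proof -
  obtain n where "b = a + of_int n * (2 * pi)"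
    using assms by (auto simp: rcong_altdef)
  then have "b = a + of_int (2 * n) * pi" by simp
  then show ?thesis unfolding rcong_altdef by blast
qed

text \<open>A negative factor turns the argument by \<pi>, which the modulus \<pi> absorbs.\<close>

lemma Arg_of_real_mult_cis:
  assumes "r \<noteq> 0"
  shows "[Arg (of_real r * cis \<phi>) = \<phi>] (rmod pi)"
proof (cases "r > 0")
  case True
  then have "[Arg (of_real r * cis \<phi>) = \<phi>] (rmod (2 * pi))"
    by (subst Arg_rcong_iff) (simp_all add: sgn_mult sgn_of_real)
  then show ?thesis by (rule rcong_mod_pi)
next
  case False
  then have "r < 0" using assms by simp
  then have "[Arg (of_real r * cis \<phi>) = \<phi> + pi] (rmod (2 * pi))"
    by (subst Arg_rcong_iff) (simp_all add: sgn_mult sgn_of_real cis_mult[symmetric])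
  then have "[Arg (of_real r * cis \<phi>) = \<phi> + pi] (rmod pi)"
    by (rule rcong_mod_pi)
  also have "[\<phi> + pi = \<phi>] (rmod pi)"
    unfolding rcong_altdef by (intro exI[of _ "- 1"]) simp
  finally show ?thesis .
qed

lemma K_uv_meridian: "\<rho> \<noteq> 0 \<Longrightarrow> [K_uv (meridian \<phi> s z \<rho>) = \<phi>] (rmod pi)"
  by (simp add: K_uv_def uv_meridian Arg_of_real_mult_cis)

lemma K_xy_meridian: "s \<noteq> 0 \<Longrightarrow> [K_xy (meridian \<phi> s z \<rho>) + pi / 2 = \<phi>] (rmod pi)"
  using rcong_add[OF Arg_of_real_mult_cis[of s "\<phi> - pi / 2"] rcong_refl[of "pi / 2" pi]]
  by (simp add: K_xy_def xy_meridian)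

lemma K_joint_meridian:
  assumes "s \<noteq> 0 \<or> \<rho> \<noteq> 0"
  shows "[K_joint (meridian \<phi> s z \<rho>) = \<phi>] (rmod pi)"
  using assms K_uv_meridian K_xy_meridian
  by (auto simp: K_joint_def uv_meridian)

lemma K_uv_K_xy:
  assumes "p \<in> zero_level" "uv p \<noteq> 0" "xy p \<noteq> 0"
  shows "[K_uv p = K_xy p + pi / 2] (rmod pi)"
proof -
  obtain \<phi> s z \<rho> where p: "p = meridian \<phi> s z \<rho>"
    by (rule zero_level_meridian[OF assms(1)])
  have "s \<noteq> 0" "\<rho> \<noteq> 0"
    using assms(2,3) unfolding p by (auto simp: xy_meridian uv_meridian)
  then show ?thesis
    unfolding p by (rule rcong_trans[OF K_uv_meridian rcong_sym[OF K_xy_meridian], rotated])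
qed

lemma bounded_linear_xy: "bounded_linear xy" and bounded_linear_uv: "bounded_linear uv"
  unfolding linear_conv_bounded_linear[symmetric]
  by (rule linearI; simp add: xy_def uv_def complex_eq_iff)+

lemma angle_smooth_on_Arg:
  assumes "bounded_linear l" "\<And>p. p \<in> D \<Longrightarrow> l p \<noteq> 0"
  shows "angle_smooth_on (2 * pi) (\<lambda>p. Arg (l p)) D"
  unfolding angle_smooth_on_def smooth_lift_def
proof
  fix p assume "p \<in> D"
  then obtain U K where "p \<in> U" "smooth_on U K"
    "\<And>q. q \<in> U \<Longrightarrow> l q \<noteq> 0 \<and> [K q = Arg (l q)] (rmod (2 * pi))"
    using smooth_lift_Arg[OF assms(1) assms(2)] by metis
  then show "\<exists>U K. p \<in> U \<and> smooth_on U K \<and> (\<forall>q\<in>U \<inter> D. [K q = Arg (l q)] (rmod (2 * pi)))"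
    by blast
qed

lemma smooth_on_add_const: "smooth_on U K \<Longrightarrow> smooth_on U (\<lambda>q. K q + c)"
  by (simp add: smooth_on_def Ck_on_add Ck_on_const)

text \<open>At a point with (u, v) = 0 the lift of \<open>K_xy\<close> + \<pi>/2 serves also the
  neighbours with (u, v) nonzero, where \<open>K_joint\<close> switches to \<open>K_uv\<close>: on
  the zero level the two agree modulo \<pi>.\<close>

lemma angle_smooth_on_K_joint: "angle_smooth_on pi K_joint (zero_level - {north, south})"
  unfolding angle_smooth_on_def smooth_lift_def
proof
  fix p assume p: "p \<in> zero_level - {north, south}"
  show "\<exists>U K. p \<in> U \<and> smooth_on U K \<and> (\<forall>q\<in>U \<inter> (zero_level - {north, south}). [K q = K_joint q] (rmod pi))"
  proof (cases "uv p = 0")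
    case False
    obtain U K where UK: "p \<in> U" "smooth_on U K"
      "\<And>q. q \<in> U \<Longrightarrow> uv q \<noteq> 0 \<and> [K q = Arg (uv q)] (rmod (2 * pi))"
      using smooth_lift_Arg[OF bounded_linear_uv False] by blast
    then have "[K q = K_joint q] (rmod pi)" if "q \<in> U" for q
      using that rcong_mod_pi by (simp add: K_joint_def K_uv_def)
    with UK show ?thesis by blast
  next
    case True
    then have "xy p \<noteq> 0"
      using p poles_iff[of p] by (auto simp: zero_level_def)
    then obtain U K where UK: "p \<in> U" "smooth_on U K"
      "\<And>q. q \<in> U \<Longrightarrow> xy q \<noteq> 0 \<and> [K q = Arg (xy q)] (rmod (2 * pi))"
      using smooth_lift_Arg[OF bounded_linear_xy] by blast
    have "[K q + pi / 2 = K_joint q] (rmod pi)" if q: "q \<in> U \<inter> zero_level" for q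
    proof -
      have *: "[K q + pi / 2 = K_xy q + pi / 2] (rmod pi)"
        using q UK(3) rcong_mod_pi by (simp add: K_xy_def)
      show ?thesis
      proof (cases "uv q = 0")
        case True
        then show ?thesis using * by (simp add: K_joint_def)
      next
        case False
        then have "[K_uv q = K_xy q + pi / 2] (rmod pi)"
          using q UK(3) K_uv_K_xy by blast
        from rcong_trans[OF * rcong_sym[OF this]] show ?thesis
          using False by (simp add: K_joint_def)
      qed
    qed
    with UK smooth_on_add_const[OF UK(2), of "pi / 2"] show ?thesis by blast
  qed
qed

section \<open>The angles along the rotation and along the flow\<close>

lemma rotation_has_vector_derivative:
  "((\<lambda>t. rotation t p) has_vector_derivative rotation_field p) (at 0)"
  unfolding rotation_def
  by (auto intro!: derivative_eq_intros simp: has_real_derivative_iff_has_vector_derivative[symmetric])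

lemma rotation_0: "rotation 0 p = p"
  by (simp add: rotation_def)

lemma rotation_nth:
  "fst (rotation t p) $ 1 = cos t * fst p $ 1 - sin t * fst p $ 2"
  "fst (rotation t p) $ 2 = cos t * fst p $ 2 + sin t * fst p $ 1"
  "fst (rotation t p) $ 3 = fst p $ 3"
  "snd (rotation t p) $ 1 = cos t * snd p $ 1 - sin t * snd p $ 2"
  "snd (rotation t p) $ 2 = cos t * snd p $ 2 + sin t * snd p $ 1"
  by (simp_all add: rotation_def rotation_field_def north_def vector_3 vector_2 algebra_simps)

lemma uv_rotation: "uv (rotation t p) = cis t * uv p"
  and xy_rotation: "xy (rotation t p) = cis t * xy p"
  by (simp_all add: uv_def xy_def rotation_nth complex_eq_iff)

lemma rotation_phase_space: "rotation t p \<in> phase_space \<longleftrightarrow> p \<in> phase_space"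
proof -
  have "(cos t * x - sin t * y)\<^sup>2 + (cos t * y + sin t * x)\<^sup>2 = x\<^sup>2 + y\<^sup>2" for x y
    using sin_cos_squared_add[of t] by algebra
  then show ?thesis
    by (simp add: phase_space_iff rotation_nth)
qed

lemma H_rotation: "H (rotation t p) = H p"
proof -
  have "(cos t * x - sin t * y) * (cos t * u - sin t * v) + (cos t * y + sin t * x) * (cos t * v + sin t * u) =
      x * u + y * v" for x y u v
    using sin_cos_squared_add[of t] by algebra
  then show ?thesis
    by (simp add: H_def rotation_nth)
qed

lemma Arg_cis_mult: "w \<noteq> 0 \<Longrightarrow> [Arg (cis t * w) = Arg w + t] (rmod (2 * pi))"
  by (subst Arg_rcong_iff) (simp_all add: sgn_mult cis_mult[symmetric] cis_Arg mult.commute)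

text \<open>A continuous nonzero radius keeps its sign for a short time, and positive factors do not
  change \<open>Arg\<close>. This yields constancy modulo 2 \<pi>.\<close>

lemma eventually_Arg_ray:
  fixes r :: "real \<Rightarrow> real"
  assumes "isCont r 0" "r 0 \<noteq> 0"
  shows "\<forall>\<^sub>F t in nhds 0. r t \<noteq> 0 \<and> Arg (of_real (r t) * cis \<phi>) = Arg (of_real (r 0) * cis \<phi>)"
proof -
  have "((\<lambda>t. r t / r 0) \<longlongrightarrow> r 0 / r 0) (nhds 0)"
    using assms by (intro tendsto_intros) (simp_all add: continuous_at tendsto_at_iff_tendsto_nhds)
  then have "\<forall>\<^sub>F t in nhds 0. r t / r 0 > 0"
    using assms(2) by (intro order_tendstoD(1)) auto
  then show ?thesis
  proof eventually_elim
    case (elim t)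
    then have "r t \<noteq> 0" by auto
    moreover have "Arg (of_real (r t / r 0) * (of_real (r 0) * cis \<phi>)) = Arg (of_real (r 0) * cis \<phi>)"
      by (rule Arg_times_of_real[OF elim])
    ultimately show ?case using assms(2) by simp
  qed
qed

text \<open>Reduces all three claims to the behaviour of the raw angle \<open>F\<close> along two
  explicit curves. The flow condition is local in time, since the curve may leave \<open>D\<close>
  later.\<close>

lemma third_constantI:
  assumes "lam > 0" "mu > 0" "m > 0" "angle_smooth_on m F D"
    and D: "D \<subseteq> phase_space" "\<And>p. p \<in> D \<Longrightarrow> uv p \<noteq> 0 \<or> xy p \<noteq> 0"
    and rot: "\<And>p t. p \<in> D \<Longrightarrow> rotation t p \<in> D \<and> [F (rotation t p) = F p + t] (rmod m)"
    and flow: "\<And>\<phi> s z \<rho>. pendulum lam mu s z \<rho> \<Longrightarrow> (\<And>t. s t \<noteq> 0 \<or> \<rho> t \<noteq> 0) \<Longrightarrow>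
      meridian \<phi> (s 0) (z 0) (\<rho> 0) \<in> D \<Longrightarrow>
      \<forall>\<^sub>F t in nhds 0. meridian \<phi> (s t) (z t) (\<rho> t) \<in> D \<and>
        [F (meridian \<phi> (s t) (z t) (\<rho> t)) = F (meridian \<phi> (s 0) (z 0) (\<rho> 0))] (rmod m)"
  shows "third_constant lam mu m F D"
  unfolding third_constant_def
proof (intro conjI allI impI assms(4); elim conjE)
  fix p U K
  assume p: "p \<in> D" "H p = 0" and lift: "smooth_lift m F D p U K"
  have ps: "p \<in> phase_space" using p D by blast
  have diff: "K differentiable (at p)"
    using lift smooth_on_differentiable by (auto simp: smooth_lift_def)
  have "frechet_derivative K (at p) (rotation_field p) = 1"
    using rot[OF p(1)]
    by (intro smooth_lift_derivative_along_curve[OF lift \<open>m > 0\<close> rotation_has_vector_derivative])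
      (simp_all add: rotation_0)
  moreover have "linear (frechet_derivative K (at p))"
    using diff frechet_derivative_works has_derivative_linear by blast
  ultimately show "independent_at p (L lam mu) H K"
    using independent_at_L_H[OF assms(1,2) ps p(2) D(2)[OF p(1)]] by simp
  have "p \<in> zero_level"
    using ps p(2) by (simp add: zero_level_def)
  then obtain \<phi> s z \<rho> where flow_p: "pendulum lam mu s z \<rho>" "p = meridian \<phi> (s 0) (z 0) (\<rho> 0)"
    "\<And>t. s t \<noteq> 0 \<or> \<rho> t \<noteq> 0"
    using zero_level_pendulum[OF assms(1,2) _ D(2)[OF p(1)]] by metis
  define \<gamma> where "\<gamma> = (\<lambda>t. meridian \<phi> (s t) (z t) (\<rho> t))"
  have "(\<gamma> has_vector_derivative H_field lam mu p) (at 0)"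
    using pendulum_integral_curve[OF assms(1,2) flow_p(1), of \<phi>] ham_vf_H[OF assms(1,2) ps] flow_p(2)
    unfolding integral_curve_def \<gamma>_def by (metis UNIV_I)
  then have "frechet_derivative K (at p) (H_field lam mu p) = 0"
    using flow[OF flow_p(1,3), of \<phi>] p(1)
    by (intro smooth_lift_derivative_along_curve[OF lift \<open>m > 0\<close>, of \<gamma>]) (auto simp: \<gamma>_def flow_p(2))
  then show "poisson lam mu K H p = 0"
    by (simp add: poisson_H[OF assms(1,2) ps diff])
qed

lemma third_constant_K_uv:
  assumes "lam > 0" "mu > 0"
  shows "third_constant lam mu (2 * pi) K_uv dom_uv"
proof (rule third_constantI[OF assms])
  show "angle_smooth_on (2 * pi) K_uv dom_uv"
    unfolding K_uv_def by (rule angle_smooth_on_Arg[OF bounded_linear_uv]) (simp add: dom_uv_def)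
  show "rotation t p \<in> dom_uv \<and> [K_uv (rotation t p) = K_uv p + t] (rmod (2 * pi))" if "p \<in> dom_uv" for p t
    using that by (simp add: dom_uv_def rotation_phase_space K_uv_def uv_rotation Arg_cis_mult)
next
  fix \<phi> s z \<rho>
  assume *: "pendulum lam mu s z \<rho>" "meridian \<phi> (s 0) (z 0) (\<rho> 0) \<in> dom_uv"
  have "isCont \<rho> 0"
    using *(1) DERIV_isCont unfolding pendulum_def by blast
  moreover have "\<rho> 0 \<noteq> 0"
    using *(2) by (auto simp: dom_uv_def uv_meridian)
  ultimately have "\<forall>\<^sub>F t in nhds 0. \<rho> t \<noteq> 0 \<and> Arg (of_real (\<rho> t) * cis \<phi>) = Arg (of_real (\<rho> 0) * cis \<phi>)"
    by (rule eventually_Arg_ray)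
  then show "\<forall>\<^sub>F t in nhds 0. meridian \<phi> (s t) (z t) (\<rho> t) \<in> dom_uv \<and>
      [K_uv (meridian \<phi> (s t) (z t) (\<rho> t)) = K_uv (meridian \<phi> (s 0) (z 0) (\<rho> 0))] (rmod (2 * pi))"
    by eventually_elim (use *(1) in \<open>simp add: dom_uv_def uv_meridian K_uv_def pendulum_def\<close>)
qed (auto simp: dom_uv_def)

lemma third_constant_K_xy:
  assumes "lam > 0" "mu > 0"
  shows "third_constant lam mu (2 * pi) K_xy dom_xy"
proof (rule third_constantI[OF assms])
  show "angle_smooth_on (2 * pi) K_xy dom_xy"
    unfolding K_xy_def by (rule angle_smooth_on_Arg[OF bounded_linear_xy]) (simp add: dom_xy_def)
  show "rotation t p \<in> dom_xy \<and> [K_xy (rotation t p) = K_xy p + t] (rmod (2 * pi))" if "p \<in> dom_xy" for p t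
    using that by (simp add: dom_xy_def rotation_phase_space K_xy_def xy_rotation Arg_cis_mult)
next
  fix \<phi> s z \<rho>
  assume *: "pendulum lam mu s z \<rho>" "meridian \<phi> (s 0) (z 0) (\<rho> 0) \<in> dom_xy"
  have "isCont s 0"
    using *(1) DERIV_isCont unfolding pendulum_def by blast
  moreover have "s 0 \<noteq> 0"
    using *(2) by (auto simp: dom_xy_def xy_meridian)
  ultimately have "\<forall>\<^sub>F t in nhds 0. s t \<noteq> 0 \<and>
      Arg (of_real (s t) * cis (\<phi> - pi / 2)) = Arg (of_real (s 0) * cis (\<phi> - pi / 2))"
    by (rule eventually_Arg_ray)
  then show "\<forall>\<^sub>F t in nhds 0. meridian \<phi> (s t) (z t) (\<rho> t) \<in> dom_xy \<and>
      [K_xy (meridian \<phi> (s t) (z t) (\<rho> t)) = K_xy (meridian \<phi> (s 0) (z 0) (\<rho> 0))] (rmod (2 * pi))"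
    by eventually_elim (use *(1) in \<open>simp add: dom_xy_def xy_meridian K_xy_def pendulum_def\<close>)
qed (auto simp: dom_xy_def)

lemma mem_zero_level_minus_poles:
  "p \<in> zero_level - {north, south} \<longleftrightarrow> p \<in> phase_space \<and> H p = 0 \<and> (uv p \<noteq> 0 \<or> xy p \<noteq> 0)"
  using poles_iff[of p] by (auto simp: zero_level_def)

lemma third_constant_K_joint:
  assumes "lam > 0" "mu > 0"
  shows "third_constant lam mu pi K_joint (zero_level - {north, south})"
proof (rule third_constantI[OF assms])
  show "angle_smooth_on pi K_joint (zero_level - {north, south})"
    by (rule angle_smooth_on_K_joint)
  show "rotation t p \<in> zero_level - {north, south} \<and> [K_joint (rotation t p) = K_joint p + t] (rmod pi)"
    if "p \<in> zero_level - {north, south}" for p t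
  proof -
    have p: "p \<in> phase_space" "H p = 0" "uv p \<noteq> 0 \<or> xy p \<noteq> 0"
      using that unfolding mem_zero_level_minus_poles by auto
    have "[K_joint (rotation t p) = K_joint p + t] (rmod pi)"
    proof (cases "uv p = 0")
      case True
      then have "[Arg (cis t * xy p) + pi / 2 = (Arg (xy p) + t) + pi / 2] (rmod pi)"
        using p(3) Arg_cis_mult rcong_mod_pi by auto
      then show ?thesis
        using True by (simp add: K_joint_def K_xy_def uv_rotation xy_rotation add_ac)
    next
      case False
      then show ?thesis
        by (simp add: K_joint_def K_uv_def uv_rotation Arg_cis_mult rcong_mod_pi)
    qed
    with p show ?thesis
      unfolding mem_zero_level_minus_poles
      by (simp add: rotation_phase_space H_rotation uv_rotation xy_rotation)
  qed
next
  fix \<phi> s z \<rho>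
  assume *: "pendulum lam mu s z \<rho>" "\<And>t. s t \<noteq> 0 \<or> \<rho> t \<noteq> 0"
  \<comment> \<open>Here the orbit never leaves the domain: s and \<rho> do not vanish together, and
    at the zeros of either one the joint angle is still \<phi> modulo \<pi>.\<close>
  have "meridian \<phi> (s t) (z t) (\<rho> t) \<in> zero_level - {north, south}" for t
    using * unfolding mem_zero_level_minus_poles by (simp add: pendulum_def uv_meridian xy_meridian disj_commute)
  moreover have "[K_joint (meridian \<phi> (s t) (z t) (\<rho> t)) = K_joint (meridian \<phi> (s 0) (z 0) (\<rho> 0))] (rmod pi)" for t
    by (intro rcong_trans[OF K_joint_meridian rcong_sym[OF K_joint_meridian]] *(2))
  ultimately show "\<forall>\<^sub>F t in nhds 0. meridian \<phi> (s t) (z t) (\<rho> t) \<in> zero_level - {north, south} \<and>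
      [K_joint (meridian \<phi> (s t) (z t) (\<rho> t)) = K_joint (meridian \<phi> (s 0) (z 0) (\<rho> 0))] (rmod pi)"
    by simp
qed (use mem_zero_level_minus_poles in auto)

section \<open>Global behaviour of the orbits on the zero level\<close>

lemma K_joint_orbit:
  assumes "lam > 0" "mu > 0" "p \<in> zero_level" "q \<in> orbit lam mu H p"
  shows "[K_joint q = K_joint p] (rmod pi)"
proof (cases "p = north \<or> p = south")
  \<comment> \<open>\<open>K_joint\<close> has an arbitrary value at a pole, but the orbit is that
    single point.\<close>
  case True
  from complete_curve_equilibrium[OF assms(1,2) this]
  have "orbit lam mu H p = {p}"
    by (simp add: complete_curve_of_def)
  then have "q = p" using assms(4) by simp
  then show ?thesis by simp
next
  case False
  then have "uv p \<noteq> 0 \<or> xy p \<noteq> 0"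
    using assms(3) mem_zero_level_minus_poles by blast
  then obtain \<phi> s z \<rho> where *: "pendulum lam mu s z \<rho>" "p = meridian \<phi> (s 0) (z 0) (\<rho> 0)"
    "\<And>t. s t \<noteq> 0 \<or> \<rho> t \<noteq> 0"
    using zero_level_pendulum[OF assms(1-3)] by metis
  then have "q \<in> range (\<lambda>t. meridian \<phi> (s t) (z t) (\<rho> t))"
    using complete_curve_pendulum[OF assms(1,2) *(1), of \<phi>] assms(4)
    by (simp add: complete_curve_of_def)
  then obtain t where "q = meridian \<phi> (s t) (z t) (\<rho> t)" by blast
  then show ?thesis
    using rcong_trans[OF K_joint_meridian[OF *(3)] rcong_sym[OF K_joint_meridian[OF *(3)]]] *(2) by simp
qed

lemma zero_level_closed_orbit:
  assumes "lam > 0" "mu > 0" "p \<in> zero_level" "L lam mu p \<noteq> 0 \<or> p = north"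
  shows "closed_orbit lam mu H p"
proof (cases "p = north \<or> p = south")
  case True
  then show ?thesis
    using complete_curve_equilibrium[OF assms(1,2)] zero_less_one
    unfolding closed_orbit_def by blast
next
  case False
  then have "L lam mu p \<noteq> 0" and "uv p \<noteq> 0 \<or> xy p \<noteq> 0"
    using assms(3,4) mem_zero_level_minus_poles[of p] by auto
  from this(2,1) obtain \<phi> s z \<rho> T where flow: "pendulum lam mu s z \<rho>" "p = meridian \<phi> (s 0) (z 0) (\<rho> 0)"
    and T: "T > 0" "\<And>t. s (t + T) = s t \<and> z (t + T) = z t \<and> \<rho> (t + T) = \<rho> t"
    using zero_level_periodic[OF assms(1-3)] by metis
  have "complete_curve_of lam mu H p (\<lambda>t. meridian \<phi> (s t) (z t) (\<rho> t))"
    using complete_curve_pendulum[OF assms(1,2) flow(1)] flow(2) by simp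
  with T show ?thesis
    unfolding closed_orbit_def by (intro exI[of _ "\<lambda>t. meridian \<phi> (s t) (z t) (\<rho> t)"] exI[of _ T]) simp
qed

text \<open>The explicit solution tends to \<open>north\<close> in both time directions. Its closure
  is recognized as the injective continuous image of the circle of all (z, s), on which the energy
  determines \<rho>.\<close>

lemma zero_level_homoclinic_orbit:
  assumes "lam > 0" "mu > 0" "p \<in> zero_level" "L lam mu p = 0" "p \<noteq> north"
  shows "homoclinic_orbit lam mu H north p"
    and "closure (orbit lam mu H p) = insert north (orbit lam mu H p)"
    and "closure (orbit lam mu H p) homeomorphic sphere (0::complex) 1"
proof -
  \<comment> \<open>At \<open>south\<close> the value of \<open>L\<close> is - 2 lam.\<close>
  have "p \<noteq> south"
    using assms(1,4) by (auto simp: L_def south_def vector_3)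
  then have "uv p \<noteq> 0 \<or> xy p \<noteq> 0"
    using assms(3,5) mem_zero_level_minus_poles by blast
  then obtain \<phi> A \<tau>0 where A: "A > 0" "mu * A\<^sup>2 = 4 * lam" and
    "p = meridian \<phi> (- (2 * sinh \<tau>0 / (cosh \<tau>0)\<^sup>2)) (1 - 2 / (cosh \<tau>0)\<^sup>2) (A * (1 / cosh \<tau>0))"
    by (rule zero_level_separatrix[OF assms(1-3) _ assms(4)])
  define \<tau> where "\<tau> = (\<lambda>t. t / (mu * A) + \<tau>0)"
  define s where "s = (\<lambda>t. - (2 * sinh (\<tau> t) / (cosh (\<tau> t))\<^sup>2))"
  define z where "z = (\<lambda>t. 1 - 2 / (cosh (\<tau> t))\<^sup>2)"
  define \<rho> where "\<rho> = (\<lambda>t. A * (1 / cosh (\<tau> t)))"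
  have pend: "pendulum lam mu s z \<rho>"
    unfolding s_def z_def \<rho>_def \<tau>_def by (rule pendulum_separatrix[OF assms(1,2) A])
  have p_eq: "p = meridian \<phi> (s 0) (z 0) (\<rho> 0)"
    unfolding s_def z_def \<rho>_def \<tau>_def using \<open>p = _\<close> by simp
  have sz\<rho>: "s t = - (2 * tanh (\<tau> t) * (1 / cosh (\<tau> t)))" "z t = 1 - 2 * (1 / cosh (\<tau> t))\<^sup>2"
    "\<rho> t = A * (1 / cosh (\<tau> t))" for t
    by (simp_all add: s_def z_def \<rho>_def tanh_def power2_eq_square)
  define \<gamma> where "\<gamma> = (\<lambda>t. meridian \<phi> (s t) (z t) (\<rho> t))"
  have curve: "complete_curve_of lam mu H p \<gamma>"
    unfolding \<gamma>_def p_eq by (rule complete_curve_pendulum[OF assms(1,2) pend])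
  then have range: "range \<gamma> = orbit lam mu H p"
    by (simp add: complete_curve_of_def)
  have \<tau>_top: "filterlim \<tau> at_top at_top" and \<tau>_bot: "filterlim \<tau> at_bot at_bot"
  proof -
    have \<tau>: "\<tau> = (\<lambda>t. \<tau>0 + 1 / (mu * A) * t)"
      by (simp add: \<tau>_def fun_eq_iff)
    have c: "0 < 1 / (mu * A)"
      using assms(2) A(1) by simp
    show "filterlim \<tau> at_top at_top" "filterlim \<tau> at_bot at_bot"
      unfolding \<tau>
      unfolding filterlim_tendsto_add_at_top_iff[OF tendsto_const]
        filterlim_tendsto_add_at_bot_iff[OF tendsto_const]
      by (rule filterlim_tendsto_pos_mult_at_top[OF tendsto_const c filterlim_ident],
          rule filterlim_tendsto_pos_mult_at_bot[OF tendsto_const c filterlim_ident])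
  qed
  \<comment> \<open>One statement for both ends of time: c is 1 or - 1, and tanh times 1 / cosh
    tends to 0 in either case.\<close>
  have lim: "(\<gamma> \<longlongrightarrow> north) F" if "((\<lambda>t. 1 / cosh (\<tau> t)) \<longlongrightarrow> 0) F" "((\<lambda>t. tanh (\<tau> t)) \<longlongrightarrow> c) F" for F c
  proof -
    have "(\<gamma> \<longlongrightarrow> meridian \<phi> (- (2 * c * 0)) (1 - 2 * 0\<^sup>2) (A * 0)) F"
      unfolding \<gamma>_def sz\<rho> meridian_def by (intro tendsto_intros that)
    then show ?thesis by (simp add: meridian_poles)
  qed
  have "((\<lambda>t. 1 / cosh t) \<longlongrightarrow> (0::real)) at_top" "((\<lambda>t. 1 / cosh t) \<longlongrightarrow> (0::real)) at_bot"
    unfolding inverse_eq_divide[symmetric]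
    by (intro tendsto_inverse_0_at_top cosh_real_at_top cosh_real_at_bot)+
  then have top: "(\<gamma> \<longlongrightarrow> north) at_top" and bot: "(\<gamma> \<longlongrightarrow> north) at_bot"
    using tanh_real_at_top tanh_real_at_bot \<tau>_top \<tau>_bot
    by (auto intro!: lim filterlim_compose[OF _ \<tau>_top] filterlim_compose[OF _ \<tau>_bot])
  have "\<gamma> t \<noteq> north" for t
  proof
    assume "\<gamma> t = north"
    then have "uv (meridian \<phi> (s t) (z t) (\<rho> t)) = uv north"
      by (simp add: \<gamma>_def)
    moreover have "uv north = 0"
      by (simp add: uv_def north_def complex_eq_iff)
    ultimately have "\<rho> t = 0"
      by (simp add: uv_meridian)
    then show False using A(1) by (simp add: sz\<rho>)
  qed
  then have "north \<notin> range \<gamma>" by (metis rangeE)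
  with curve top bot show "homoclinic_orbit lam mu H north p"
    unfolding homoclinic_orbit_def by blast
  \<comment> \<open>Re c is the height z and Im c is s; L = 0 and \<rho> \<ge> 0 give the last
    argument. The point c = 1 is mapped to \<open>north\<close>.\<close>
  define \<Phi> where "\<Phi> = (\<lambda>c. meridian \<phi> (Im c) (Re c) (A * sqrt ((1 - Re c) / 2)))"
  have cont: "continuous_on (sphere 0 1) \<Phi>"
    unfolding \<Phi>_def meridian_def by (intro continuous_intros) auto
  have inj: "inj_on \<Phi> (sphere 0 1)"
  proof (rule inj_onI)
    fix c d assume eq: "\<Phi> c = \<Phi> d"
    have "Re c = Re d"
      using arg_cong[OF eq, of "\<lambda>p. fst p $ 3"] by (simp add: \<Phi>_def)
    moreover have "of_real (Im c) * cis (\<phi> - pi / 2) = of_real (Im d) * cis (\<phi> - pi / 2)"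
      using arg_cong[OF eq, of xy] by (simp add: \<Phi>_def xy_meridian)
    then have "Im c = Im d" by simp
    ultimately show "c = d" by (simp add: complex_eq_iff)
  qed
  have image: "\<Phi> ` sphere 0 1 = insert north (range \<gamma>)"
  proof (intro subset_antisym subsetI)
    fix q assume "q \<in> \<Phi> ` sphere 0 1"
    then obtain c where c: "(Im c)\<^sup>2 + (Re c)\<^sup>2 = 1" and q: "q = \<Phi> c"
      by (auto simp: cmod_def add.commute)
    show "q \<in> insert north (range \<gamma>)"
    proof (cases "Re c = 1")
      case True
      then show ?thesis using c by (simp add: q \<Phi>_def meridian_poles)
    next
      case False
      then obtain \<sigma> where \<sigma>: "Im c = - (2 * sinh \<sigma> / (cosh \<sigma>)\<^sup>2)" "Re c = 1 - 2 / (cosh \<sigma>)\<^sup>2"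
        "sqrt ((1 - Re c) / 2) = 1 / cosh \<sigma>"
        using separatrix_parameter[OF c] by blast
      \<comment> \<open>The time at which the orbit passes the point with parameter
        \<sigma>.\<close>
      have "\<tau> (mu * A * (\<sigma> - \<tau>0)) = \<sigma>"
        using assms(2) A(1) by (simp add: \<tau>_def)
      then have "\<gamma> (mu * A * (\<sigma> - \<tau>0)) = \<Phi> c"
        unfolding \<gamma>_def \<Phi>_def s_def z_def \<rho>_def \<sigma>(3) by (simp only: \<sigma>(1,2))
      then show ?thesis unfolding q by (metis insertI2 rangeI)
    qed
  next
    fix q assume "q \<in> insert north (range \<gamma>)"
    then consider "q = north" | t where "q = \<gamma> t" by blast
    then show "q \<in> \<Phi> ` sphere 0 1"
    proof cases
      case 1
      then have "q = \<Phi> 1" by (simp add: \<Phi>_def meridian_poles)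
      then show ?thesis by simp
    next
      case 2
      have "(1 - z t) / 2 = (1 / cosh (\<tau> t))\<^sup>2"
        by (simp add: sz\<rho>)
      then have "sqrt ((1 - z t) / 2) = 1 / cosh (\<tau> t)"
        by (simp add: real_sqrt_unique)
      then have "q = \<Phi> (Complex (z t) (s t))"
        unfolding 2 \<gamma>_def \<Phi>_def by (simp add: sz\<rho>(3))
      moreover have "(z t)\<^sup>2 + (s t)\<^sup>2 = 1"
        using pend by (simp add: pendulum_def add.commute)
      then have "Complex (z t) (s t) \<in> sphere 0 1"
        by (simp add: cmod_def)
      ultimately show ?thesis by blast
    qed
  qed
  have "compact (\<Phi> ` sphere 0 1)"
    by (intro compact_continuous_image cont) simp
  then have closed: "closed (insert north (range \<gamma>))"
    unfolding image by (rule compact_imp_closed)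
  have north: "north \<in> closure (range \<gamma>)"
  proof (rule Lim_in_closed_set[OF closed_closure _ _ top])
    show "\<forall>\<^sub>F t in at_top. \<gamma> t \<in> closure (range \<gamma>)"
      by (intro always_eventually allI subsetD[OF closure_subset rangeI])
  qed simp
  have closure: "closure (range \<gamma>) = insert north (range \<gamma>)"
    using closure_minimal[OF subset_insertI closed] north closure_subset[of "range \<gamma>"]
    by - (rule subset_antisym, simp_all)
  then show "closure (orbit lam mu H p) = insert north (orbit lam mu H p)"
    by (simp add: range)
  have "sphere (0::complex) 1 homeomorphic \<Phi> ` sphere 0 1"
    by (rule homeomorphic_compact[OF _ cont refl inj]) simp
  then show "closure (orbit lam mu H p) homeomorphic sphere (0::complex) 1"
    unfolding image range[symmetric] closure by (rule homeomorphic_sym[THEN iffD1])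
qed

text \<open>Orbits with L = 0 other than \<open>north\<close> have no period: they close up to a
  circle only when their limit point \<open>north\<close> is added, so closedness is stated for them
  through the closure. The point \<open>south\<close> has L < 0 and belongs to the periodic case.
  Smoothness almost everywhere on the zero level means smoothness off the two poles.\<close>

theorem lemma6p4:
  fixes lam mu :: real
  assumes "lam > 0" and "mu > 0"
  shows
    "third_constant lam mu (2 * pi) K_uv dom_uv \<and>
     third_constant lam mu (2 * pi) K_xy dom_xy \<and>
     (\<forall>p \<in> zero_level \<inter> dom_uv \<inter> dom_xy. [K_uv p = K_xy p + pi / 2] (rmod pi)) \<and>
     third_constant lam mu pi K_joint (zero_level - {north, south}) \<and>
     (\<forall>p \<in> zero_level. \<forall>q \<in> orbit lam mu H p. [K_joint q = K_joint p] (rmod pi)) \<and>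
     (\<forall>p \<in> zero_level. L lam mu p \<noteq> 0 \<or> p = north \<longrightarrow> closed_orbit lam mu H p) \<and>
     (\<forall>p \<in> zero_level. L lam mu p = 0 \<and> p \<noteq> north \<longrightarrow>
        homoclinic_orbit lam mu H north p \<and>
        closure (orbit lam mu H p) = insert north (orbit lam mu H p) \<and>
        closure (orbit lam mu H p) homeomorphic sphere (0::complex) 1)"
  using third_constant_K_uv[OF assms] third_constant_K_xy[OF assms] third_constant_K_joint[OF assms]
    K_uv_K_xy K_joint_orbit[OF assms] zero_level_closed_orbit[OF assms] zero_level_homoclinic_orbit[OF assms]
  by (intro conjI ballI impI) (simp_all add: dom_uv_def dom_xy_def)

end
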